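(* Let $(X,L)$ be a polarized totally degenerate abelian variety over $K=\mathbb{C}((t))$, and for sufficiently large $k$ let $$\phi_k=\frac1k\max_{\mu\in\operatorname{coker}(k\Phi)}\Big(\log|\theta^{(k)}_{m_\mu}|+\log|a^k_{k\Phi}(m_\mu)|_{\mathbb{C}_K}\Big)$$ be the non-Archimedean balanced metric on $L^{\mathrm{an}}$ at level $k$ given by theta functions. Then the metrics $\phi_k$ converge to the non-Archimedean Calabi--Yau metric $\phi^{\mathrm{NACY}}$ on $L^{\mathrm{an}}$ in the $\mathscr{C}^0$-topology as $k\to\infty$. Furthermore, $$\sup_{x\in X^{\mathrm{an}}}\left|\phi^{\mathrm{NACY}}-\phi_k\right|=O(k^{-2}).$$
   Context: **Fields and metrics.** $K=\mathbb{C}((t))$ with $|t|_K=e^{-1}$; $\overline K$ is an algebraic closure, $\mathbb{C}_K$ its completion. $X^{\mathrm{an}}$ is the Berkovich analytification; line bundles and metrics are written additively. A continuous metric $\phi$ on $L^{\mathrm{an}}$ is a family of norms $\|\cdot\|_{\phi(x)}$ on $L\otimes\mathscr{H}(x)$ ($\mathscr H(x)$ the completed residue field) with $\phi_s:=-\log\|s\|_\phi$ continuous for each local trivializing section $s$. The difference of two metrics on $L^{\mathrm{an}}$ is a metric on $\mathcal{O}$, identified with the function $-\log\|1\|$; the $\mathscr{C}^0$-topology is given by the sup norm of differences. For $s_i\in H^0(X,kL)$ without common zeros and $\lambda_i\in\mathbb{R}$, $\frac1k\max_i\{\log|s_i|+\lambda_i\}$ is the metric with $\phi_s(x)=\frac1k\max_i\{-\log|(s^k/s_i)(x)|+\lambda_i\}$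 (a NAFS metric). Continuous plurisubharmonic (cpsh) metrics on $L^{\mathrm{an}}$ are uniform limits of decreasing nets of NAFS metrics; $\mathrm{MA}(\phi)$ denotes the Monge--Ampère measure of Chambert-Loir--Ducros, a positive Radon measure on $X^{\mathrm{an}}$ of mass $(L^{\dim X})$. **Totally degenerate abelian varieties.** Let $M$ be a free $\mathbb{Z}$-module of finite rank, $N=\mathrm{Hom}(M,\mathbb{Z})$, $T=\mathrm{Spec}\,\mathbb{Z}[M]$. $X/K$ is totally degenerate if there is a surjective morphism of analytic groups $p:T_K^{\mathrm{an}}\to X^{\mathrm{an}}$ whose kernel is a lattice in $\mathrm{Hom}(M,K^\times)$ of rank $\operatorname{rank}M$, with $T_K^{\mathrm{an}}/\ker p\simeq X^{\mathrm{an}}$. For $L$ ample, $p^*L^{\mathrm{an}}$ is trivial; fixing a cubical structure on $L$ and a trivialization of $p^*L^{\mathrm{an}}$ gives data $(\Lambda,a,b,\Phi)$: a free $\mathbb{Z}$-module $\Lambda$, $a:\Lambda\to K^\times$, a bimultiplicative $b:\Lambda\times M\to K^\times$, an injective homomorphism $\Phi:\Lambda\to M$ with finite cokernel, with $a(0)=1$, $a(\lambda+\lambda')=b(\lambda,\Phi(\lambda'))a(\lambda)a(\lambda')$, $q(\lambda,\lambda'):=b(\lambda,\Phi(\lambda'))$ symmetric and $-\log|q|_K$ positive definite. $b$ identifies $\Lambda$ with $\ker p$, and $H^0(X^{\mathrm{an}},L^{\mathrm{an}})$ is the space of $f\in H^0(T_K^{\mathrm{an}},\mathcal{O})$ with $\tau_\lambda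 f=f$ for all $\lambda$, where $\tau_\lambda(z^m)=a(\lambda)b(\lambda,m)z^{m+\Phi(\lambda)}$. The trivialization is taken so that $a(\lambda)^2=q(\lambda,\lambda)$ for all $\lambda$. The data of $kL$ are $(\Lambda,a^k,b,k\Phi)$. The tropicalization $\mathrm{trop}_K:T_K^{\mathrm{an}}\to N_{\mathbb{R}}$ is $x\mapsto(m\mapsto-\log|z^m(x)|)$, with Gauss section $\mathfrak{G}:N_{\mathbb{R}}\to T_K^{\mathrm{an}}$, $\mathfrak{G}(n):\sum a_mz^m\mapsto\max|a_m|_Ke^{-\langle m,n\rangle}$. The canonical skeleton $\mathrm{Sk}(X)\subset X^{\mathrm{an}}$ is the image of the induced embedding of $N_{\mathbb{R}}/\mathrm{trop}_K(\ker p)$. **Theta functions.** For $k\ge1$ fix extensions $a^k_{k\Phi}:M\to\overline K^\times$ (a single symbol) and $b_{k\Phi}:M\times M\to\overline K^\times$, bimultiplicative and symmetric, with $a^k_{k\Phi}(k\Phi(\lambda))=a(\lambda)^k$, $b_{k\Phi}(k\Phi(\lambda),m)=b(\lambda,m)$, $a^k_{k\Phi}(m+m')=a^k_{k\Phi}(m)a^k_{k\Phi}(m')b_{k\Phi}(m,m')$, $a^k_{k\Phi}(m)^2=b_{k\Phi}(m,m)$. For $\mu\in\operatorname{coker}(k\Phi)=M/k\Phi(\Lambda)$ fix a lift $m_\mu\in M$ and put $\theta^{(k)}_{m_\mu}=\sum_{\lambda\in\Lambda}a(\lambda)^kb(\lambda,m_\mu)z^{m_\mu+k\Phi(\lambda)}\in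 H^0(X,kL)$. **NACY metric.** $\phi^{\mathrm{NACY}}$ is the cpsh metric on $L^{\mathrm{an}}$, unique up to an additive constant, solving $\mathrm{MA}(\phi)=(L^{\dim X})\mu$, where $\mu$ is the canonical (Haar) probability measure on $\mathrm{Sk}(X)\simeq N_{\mathbb{R}}/\mathrm{trop}_K(\ker p)$. The additive constant is fixed as follows. Let $B_\Phi:M_{\mathbb{R}}\times M_{\mathbb{R}}\to\mathbb{R}$ be the positive definite symmetric bilinear form determined by $B_\Phi(\Phi(\lambda),m)=-\log|b(\lambda,m)|_K$, $A_\Phi(m)=\frac12B_\Phi(m,m)$, and $A_\Phi^\vee(n)=\max_{m\in M_{\mathbb{R}}}(\langle m,n\rangle-A_\Phi(m))$ for $n\in N_{\mathbb{R}}$. Then $\phi^{\mathrm{NACY}}$ is the toric metric with $-\log\|1\|_{p^*\phi^{\mathrm{NACY}}}=A_\Phi^\vee\circ\mathrm{trop}_K$ (via the fixed trivialization of $p^*L^{\mathrm{an}}$). *)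

theory Defs
  imports
    "HOL-Analysis.Analysis"
    "HOL-Computational_Algebra.Formal_Laurent_Series"
    "HOL-Library.Poly_Mapping"
    "HOL-Library.Landau_Symbols"
    "HOL-Algebra.Algebraic_Closure_Type"
begin

text \<open>
  Conventions.  The ground field K = C((t)) is the type \<open>complex fls\<close>.  A basis of the
  character lattice M is chosen, so M is \<open>int ^ 'g\<close> and M_R is \<open>real ^ 'g\<close>; with the dual
  basis N_R is \<open>real ^ 'g\<close> as well and the pairing \<open>\<langle>m, n\<rangle>\<close> is the inner product.
  The group ring K[M] is \<open>(int ^ 'g) \<Rightarrow>\<^sub>0 complex fls\<close>, with \<open>z^m\<close> = \<open>Poly_Mapping.single m 1\<close>.
\<close>

definition absK :: "complex fls \<Rightarrow> real" where
  "absK f = (if f = 0 then 0 else exp (- real_of_int (fls_subdegree f)))"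

text \<open>Completeness of K makes the following extension unique.  It is also the restriction
  of the absolute value of the completion of the algebraic closure.\<close>

definition extends_absK :: "(complex fls alg_closure \<Rightarrow> real) \<Rightarrow> bool" where
  "extends_absK v \<longleftrightarrow>
     (\<forall>x. v x \<ge> 0) \<and> (\<forall>x. v x = 0 \<longleftrightarrow> x = 0) \<and>
     (\<forall>x y. v (x * y) = v x * v y) \<and> (\<forall>x y. v (x + y) \<le> max (v x) (v y)) \<and>
     (\<forall>c. v (to_ac c) = absK c)"

definition rvec :: "int ^ 'g \<Rightarrow> real ^ 'g" where
  "rvec m = (\<chi> i. real_of_int (m $ i))"


section \<open>The analytic torus\<close>

type_synonym 'g laurent_poly = "(int ^ 'g) \<Rightarrow>\<^sub>0 complex fls"
type_synonym 'g point = "'g laurent_poly \<Rightarrow> real"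

text \<open>Points are the multiplicative seminorms on K[M] that extend the absolute value of K.  The
  topology, the coarsest one for which all \<open>x \<mapsto> x f\<close> are continuous, is the subspace topology of
  the product topology on functions.\<close>

definition Tan :: "('g::finite) point set" where
  "Tan = {x. (\<forall>f. x f \<ge> 0) \<and> (\<forall>f h. x (f + h) \<le> max (x f) (x h)) \<and>
             (\<forall>f h. x (f * h) = x f * x h) \<and>
             (\<forall>c. x (Poly_Mapping.single 0 c) = absK c)}"

definition trop :: "('g::finite) point \<Rightarrow> real ^ 'g" where
  "trop x = (\<chi> i. - ln (x (Poly_Mapping.single (axis i 1) 1)))"

text \<open>A global analytic function on the torus is given by its coefficients \<open>c\<close>, with
  \<open>f = (\<Sum>m. c m z^m)\<close>.  Its absolute value at a point is the limit of those of the finite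
  partial sums.\<close>

definition entire :: "(int ^ 'g \<Rightarrow> complex fls) set" where
  "entire = {c. \<forall>n :: real ^ 'g.
     ((\<lambda>m. absK (c m) * exp (- (rvec m \<bullet> n))) \<longlongrightarrow> 0) cofinite}"

definition abs_at :: "(int ^ 'g \<Rightarrow> complex fls) \<Rightarrow> ('g::finite) point \<Rightarrow> real" where
  "abs_at c x = Lim (finite_subsets_at_top UNIV) (\<lambda>F. x (\<Sum>m\<in>F. Poly_Mapping.single m (c m)))"


section \<open>Polarized totally degenerate abelian varieties\<close>

definition coker :: "('l::ab_group_add \<Rightarrow> 'm::ab_group_add) \<Rightarrow> 'm set set" where
  "coker h = UNIV // {(m, m'). m' - m \<in> range h}"

definition mult_hom :: "nat \<Rightarrow> ('l \<Rightarrow> int ^ 'g) \<Rightarrow> 'l \<Rightarrow> int ^ 'g" where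
  "mult_hom k \<Phi> l = int k *s \<Phi> l"

text \<open>The data describing the pair of the variety X and the ample line bundle L on it.  That
  \<open>\<Lambda> = UNIV :: 'l set\<close> is free of finite rank follows from the injectivity of \<open>\<Phi>\<close>.  The form
  \<open>- log |q|\<close> takes integer values, so positivity on the nonzero elements of \<open>\<Lambda>\<close> is the same
  as positivity on the real span.\<close>

locale polarized_tdav =
  fixes \<Phi> :: "'l::ab_group_add \<Rightarrow> int ^ 'g::finite"
    and a :: "'l \<Rightarrow> complex fls"
    and b :: "'l \<Rightarrow> int ^ 'g \<Rightarrow> complex fls"
  assumes Phi_add: "\<Phi> (l + l') = \<Phi> l + \<Phi> l'"
    and Phi_inj: "inj \<Phi>"
    and Phi_coker: "finite (coker \<Phi>)"
    and a_nonzero: "a l \<noteq> 0"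
    and b_nonzero: "b l m \<noteq> 0"
    and b_add_left: "b (l + l') m = b l m * b l' m"
    and b_add_right: "b l (m + m') = b l m * b l m'"
    and a_zero: "a 0 = 1"
    and a_add: "a (l + l') = b l (\<Phi> l') * a l * a l'"
    and q_sym: "b l (\<Phi> l') = b l' (\<Phi> l)"
    and q_pos: "l \<noteq> 0 \<Longrightarrow> - ln (absK (b l (\<Phi> l))) > 0"
    and a_square: "a l ^ 2 = b l (\<Phi> l)"

text \<open>\<open>\<Lambda>\<close> is the kernel of the uniformization, \<open>l\<close> being the K-point \<open>z^m = b l m\<close> of the torus.
  It acts by translation, and the points of the analytification of X are the orbits.\<close>

definition translate :: "('l \<Rightarrow> int ^ 'g \<Rightarrow> complex fls) \<Rightarrow> 'l \<Rightarrow> 'g point \<Rightarrow> ('g::finite) point" where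
  "translate b l x =
     (\<lambda>f. x (\<Sum>m\<in>Poly_Mapping.keys f. Poly_Mapping.single m (b l m * Poly_Mapping.lookup f m)))"

definition Xan :: "('l \<Rightarrow> int ^ 'g \<Rightarrow> complex fls) \<Rightarrow> ('g::finite) point set set" where
  "Xan b = (\<lambda>x. range (\<lambda>l. translate b l x)) ` Tan"

text \<open>The coefficients of \<open>\<tau>\<^sub>l f\<close> for kL, where \<open>\<tau>\<^sub>l z^m = a(l)^k b(l,m) z^(m + k \<Phi>(l))\<close>.\<close>

definition tau :: "('l \<Rightarrow> int ^ 'g) \<Rightarrow> ('l \<Rightarrow> complex fls) \<Rightarrow> ('l \<Rightarrow> int ^ 'g \<Rightarrow> complex fls) \<Rightarrow>
    nat \<Rightarrow> 'l \<Rightarrow> (int ^ 'g \<Rightarrow> complex fls) \<Rightarrow> int ^ 'g \<Rightarrow> complex fls" where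
  "tau \<Phi> a b k l c m =
     a l ^ k * b l (m - mult_hom k \<Phi> l) * c (m - mult_hom k \<Phi> l)"

definition sections :: "('l \<Rightarrow> int ^ 'g) \<Rightarrow> ('l \<Rightarrow> complex fls) \<Rightarrow> ('l \<Rightarrow> int ^ 'g \<Rightarrow> complex fls) \<Rightarrow>
    nat \<Rightarrow> (int ^ 'g \<Rightarrow> complex fls) set" where
  "sections \<Phi> a b k = {c \<in> entire. \<forall>l. tau \<Phi> a b k l c = c}"


section \<open>Metrics\<close>

text \<open>A metric on L is represented by \<open>\<phi> = - log \<parallel>1\<parallel>\<close> for its pullback to the trivialized
  bundle \<open>p\<^sup>*L\<close>.  Descent to X means that \<open>\<parallel>f\<parallel> = |f| exp (- \<phi>)\<close> is constant on orbits when f is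
  invariant, that is when \<open>f(x) = a(l) z^\<Phi>(l)(x) f(l x)\<close>.\<close>

definition metrics :: "('l \<Rightarrow> int ^ 'g) \<Rightarrow> ('l \<Rightarrow> complex fls) \<Rightarrow> ('l \<Rightarrow> int ^ 'g \<Rightarrow> complex fls) \<Rightarrow>
    (('g::finite) point \<Rightarrow> real) set" where
  "metrics \<Phi> a b = {\<phi>. continuous_on Tan \<phi> \<and>
     (\<forall>l. \<forall>x\<in>Tan. \<phi> (translate b l x)
        = \<phi> x - ln (absK (a l)) - ln (x (Poly_Mapping.single (\<Phi> l) 1)))}"

text \<open>The difference of two metrics is a function on X, evaluated at any point of the orbit.\<close>

definition metric_diff :: "('g point \<Rightarrow> real) \<Rightarrow> ('g point \<Rightarrow> real) \<Rightarrow> ('g::finite) point set \<Rightarrow> real" where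
  "metric_diff \<phi> \<psi> \<xi> = (let x = (SOME x. x \<in> \<xi>) in \<phi> x - \<psi> x)"

definition sup_dist :: "('l \<Rightarrow> int ^ 'g \<Rightarrow> complex fls) \<Rightarrow>
    ('g point \<Rightarrow> real) \<Rightarrow> (('g::finite) point \<Rightarrow> real) \<Rightarrow> ereal" where
  "sup_dist b \<phi> \<psi> = (SUP \<xi>\<in>Xan b. ereal \<bar>metric_diff \<phi> \<psi> \<xi>\<bar>)"

definition C0_converges :: "('l \<Rightarrow> int ^ 'g) \<Rightarrow> ('l \<Rightarrow> complex fls) \<Rightarrow>
    ('l \<Rightarrow> int ^ 'g \<Rightarrow> complex fls) \<Rightarrow> (nat \<Rightarrow> 'g point \<Rightarrow> real) \<Rightarrow> (('g::finite) point \<Rightarrow> real) \<Rightarrow> bool" where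
  "C0_converges \<Phi> a b \<phi>s \<phi> \<longleftrightarrow>
     \<phi> \<in> metrics \<Phi> a b \<and> (\<forall>\<^sub>F k in sequentially. \<phi>s k \<in> metrics \<Phi> a b) \<and>
     (\<lambda>k. sup_dist b (\<phi>s k) \<phi>) \<longlonglongrightarrow> 0"

definition no_common_zeros :: "'i set \<Rightarrow> ('i \<Rightarrow> int ^ 'g \<Rightarrow> complex fls) \<Rightarrow> bool" where
  "no_common_zeros I s \<longleftrightarrow> (\<forall>x\<in>(Tan :: ('g::finite) point set). \<exists>i\<in>I. abs_at (s i) x \<noteq> 0)"

text \<open>\<open>1/k max\<^sub>i (log |s\<^sub>i| + r\<^sub>i)\<close> for a finite family of sections of kL without common zeros.
  Sections vanishing at \<open>x\<close> are left out of the maximum because \<open>log 0\<close> is minus infinity, whereas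
  \<open>ln 0 = 0\<close> in HOL.\<close>

definition nafs_metric :: "nat \<Rightarrow> 'i set \<Rightarrow> ('i \<Rightarrow> int ^ 'g \<Rightarrow> complex fls) \<Rightarrow> ('i \<Rightarrow> real) \<Rightarrow>
    ('g::finite) point \<Rightarrow> real" where
  "nafs_metric k I s r x =
     1 / real k * Max {ln (abs_at (s i) x) + r i | i. i \<in> I \<and> abs_at (s i) x \<noteq> 0}"


section \<open>Theta functions and the balanced metrics\<close>

text \<open>The extensions \<open>ak\<close> of \<open>a^k\<close> and \<open>bk\<close> of \<open>b\<close> from \<open>k \<Phi>(\<Lambda>)\<close> to M, with values in the
  algebraic closure.\<close>

definition theta_extension :: "('l \<Rightarrow> int ^ 'g) \<Rightarrow> ('l \<Rightarrow> complex fls) \<Rightarrow>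
    ('l \<Rightarrow> int ^ 'g \<Rightarrow> complex fls) \<Rightarrow> nat \<Rightarrow> (int ^ 'g \<Rightarrow> complex fls alg_closure) \<Rightarrow>
    (int ^ 'g \<Rightarrow> int ^ 'g \<Rightarrow> complex fls alg_closure) \<Rightarrow> bool" where
  "theta_extension \<Phi> a b k ak bk \<longleftrightarrow>
     (\<forall>m. ak m \<noteq> 0) \<and> (\<forall>m m'. bk m m' \<noteq> 0) \<and>
     (\<forall>m m' n. bk (m + m') n = bk m n * bk m' n) \<and>
     (\<forall>m n n'. bk m (n + n') = bk m n * bk m n') \<and>
     (\<forall>m m'. bk m m' = bk m' m) \<and>
     (\<forall>l. ak (mult_hom k \<Phi> l) = to_ac (a l ^ k)) \<and>
     (\<forall>l m. bk (mult_hom k \<Phi> l) m = to_ac (b l m)) \<and>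
     (\<forall>m m'. ak (m + m') = ak m * ak m' * bk m m') \<and>
     (\<forall>m. ak m ^ 2 = bk m m)"

text \<open>The coefficient of \<open>z^m'\<close> in \<open>\<Sum>l. a(l)^k b(l,m) z^(m + k \<Phi>(l))\<close>; for \<open>k > 0\<close> the sum
  below has at most one term.\<close>

definition theta :: "('l \<Rightarrow> int ^ 'g) \<Rightarrow> ('l \<Rightarrow> complex fls) \<Rightarrow> ('l \<Rightarrow> int ^ 'g \<Rightarrow> complex fls) \<Rightarrow>
    nat \<Rightarrow> int ^ 'g \<Rightarrow> int ^ 'g \<Rightarrow> complex fls" where
  "theta \<Phi> a b k m m' = (\<Sum>l | m' = m + mult_hom k \<Phi> l. a l ^ k * b l m)"

definition balanced_metric :: "('l::ab_group_add \<Rightarrow> int ^ 'g) \<Rightarrow> ('l \<Rightarrow> complex fls) \<Rightarrow>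
    ('l \<Rightarrow> int ^ 'g \<Rightarrow> complex fls) \<Rightarrow> (complex fls alg_closure \<Rightarrow> real) \<Rightarrow> nat \<Rightarrow>
    (int ^ 'g \<Rightarrow> complex fls alg_closure) \<Rightarrow> ((int ^ 'g) set \<Rightarrow> int ^ 'g) \<Rightarrow>
    ('g::finite) point \<Rightarrow> real" where
  "balanced_metric \<Phi> a b v k ak lift =
     nafs_metric k (coker (mult_hom k \<Phi>))
       (\<lambda>\<mu>. theta \<Phi> a b k (lift \<mu>)) (\<lambda>\<mu>. ln (v (ak (lift \<mu>))))"


section \<open>The Calabi-Yau metric\<close>

text \<open>\<open>B_form\<close> is unique because \<open>\<Phi>(\<Lambda>)\<close> spans \<open>real ^ 'g\<close>.\<close>

definition B_form :: "('l \<Rightarrow> int ^ 'g) \<Rightarrow> ('l \<Rightarrow> int ^ 'g \<Rightarrow> complex fls) \<Rightarrow>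
    real ^ 'g::finite \<Rightarrow> real ^ 'g \<Rightarrow> real" where
  "B_form \<Phi> b = (THE B. bilinear B \<and>
     (\<forall>l m. B (rvec (\<Phi> l)) (rvec m) = - ln (absK (b l m))))"

definition A_form :: "('l \<Rightarrow> int ^ 'g) \<Rightarrow> ('l \<Rightarrow> int ^ 'g \<Rightarrow> complex fls) \<Rightarrow>
    real ^ 'g::finite \<Rightarrow> real" where
  "A_form \<Phi> b m = 1 / 2 * B_form \<Phi> b m m"

text \<open>The supremum is a maximum because \<open>B_form\<close> is positive definite.\<close>

definition A_dual :: "('l \<Rightarrow> int ^ 'g) \<Rightarrow> ('l \<Rightarrow> int ^ 'g \<Rightarrow> complex fls) \<Rightarrow>
    real ^ 'g::finite \<Rightarrow> real" where
  "A_dual \<Phi> b n = (SUP m. m \<bullet> n - A_form \<Phi> b m)"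

text \<open>The cpsh metrics solving \<open>MA(\<phi>) = (L^g) \<mu>\<close>, for \<open>\<mu>\<close> the Haar probability measure on the
  canonical skeleton, differ by additive constants, and the Calabi-Yau metric is the toric one
  among them given by the following formula.  The formula alone determines the metric; the
  Monge-Ampere operator of Chambert-Loir and Ducros is not formalized here.\<close>

definition nacy_metric :: "('l \<Rightarrow> int ^ 'g) \<Rightarrow> ('l \<Rightarrow> int ^ 'g \<Rightarrow> complex fls) \<Rightarrow>
    ('g::finite) point \<Rightarrow> real" where
  "nacy_metric \<Phi> b x = A_dual \<Phi> b (trop x)"

end

theory Submission
  imports
    Defs
    "HOL-Real_Asymp.Real_Asymp"
begin

text \<open>
  At a point with tropicalization \<open>n\<close> the character \<open>z^m\<close> weighted by \<open>a\<^sub>k(m)\<close> has logarithm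
  \<open>- \<langle>m, n\<rangle> - B(m, m) / 2k\<close>.  By strict concavity, for \<open>k \<ge> 2\<close> a maximizing \<open>m\<close> is unique in its
  class modulo \<open>k \<Phi>(\<Lambda>)\<close>, so its theta function has no cancellation and the balanced metric is the
  maximum of \<open>- \<langle>y, n\<rangle> - B(y, y) / 2\<close> over \<open>y\<close> in \<open>(1/k) M\<close>.  The Calabi-Yau metric is the maximum
  over all of \<open>M_R\<close>, and completing the square turns the difference into half the squared
  \<open>B\<close>-distance from the real maximizer to \<open>(1/k) M\<close>, which is \<open>O(1/k\<^sup>2)\<close>.
\<close>

section \<open>Integer vectors\<close>

text \<open>Two obstacles shape the proof. Positivity is assumed only on the nonzero elements of
  \<open>\<Lambda>\<close>, and a form that is positive on a lattice may still be degenerate on the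
  real span. Valuations on \<open>K\<close> are integers, however, so the form is bounded away from
  0 on nonzero lattice vectors, and this rules degeneracy out. Secondly, the extensions
  \<open>ak\<close> and \<open>bk\<close> are chosen separately for every \<open>k\<close>, with
  nothing relating different levels. Their absolute values still do not depend on the choices: a
  common positive multiple of every \<open>m\<close> lies in the image of \<open>\<Phi>\<close>, and
  logarithms of absolute values can be divided by that multiple. Hence one real form governs all
  levels. The bound \<open>k \<ge> 2\<close> cannot be lowered in general: if \<open>\<Phi>\<close>
  is bijective, level 1 has a single theta function, and it has zeros. The minus sign in front of
  the pairing comes from \<open>|z^m| = exp (- \<langle>m, n\<rangle>)\<close>; it is harmless
  because the lattice and the form are invariant under negation.\<close>

lemma rvec_add: "rvec (m + m') = rvec m + rvec m'"
  by (simp add: rvec_def vec_eq_iff)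

lemma rvec_scale: "rvec (int n *s m) = real n *\<^sub>R rvec m"
  by (simp add: rvec_def vec_eq_iff)

lemma rvec_0 [simp]: "rvec 0 = 0"
  by (simp add: rvec_def vec_eq_iff)

lemma rvec_eq_0_iff [simp]: "rvec m = 0 \<longleftrightarrow> m = 0"
  by (simp add: rvec_def vec_eq_iff)

lemma rvec_axis: "rvec (axis i 1) = axis i 1"
  by (simp add: rvec_def vec_eq_iff axis_def)

text \<open>Applied to \<open>- ln\<close> of multiplicative functions on M. It yields both the
  pairing with \<open>trop x\<close> and the extension of the form from M to the real span.\<close>

lemma int_vec_expansion:
  fixes f :: "int ^ 'g::finite \<Rightarrow> real"
  assumes add: "\<And>m m'. f (m + m') = f m + f m'"
  shows "f m = (\<Sum>i\<in>UNIV. real_of_int (m $ i) * f (axis i 1))"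
proof -
  have f0: "f 0 = 0"
    using add[of 0 0] by simp
  have neg: "f (- m) = - f m" for m
    using add[of m "- m"] f0 by simp
  have nat_scale: "f (int n *s m) = real n * f m" for n m
    by (induction n) (simp_all add: f0 add vector_sadd_rdistrib algebra_simps)
  have scale: "f (c *s m) = real_of_int c * f m" for c m
  proof (cases "c \<ge> 0")
    case True
    then show ?thesis using nat_scale[of "nat c" m] by simp
  next
    case False
    then have "f (- (c *s m)) = real_of_int (- c) * f m"
      using nat_scale[of "nat (- c)" m] by (simp add: vector_sneg_minus1)
    then show ?thesis by (simp add: neg)
  qed
  have sum: "f (sum h I) = (\<Sum>i\<in>I. f (h i))" if "finite I" for h :: "'g \<Rightarrow> _" and I
    using that by induction (simp_all add: f0 add)
  have "m = (\<Sum>i\<in>UNIV. (m $ i) *s axis i 1)"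
    by (simp add: vec_eq_iff axis_def if_distrib sum.delta cong: if_cong)
  then have "f m = f (\<Sum>i\<in>UNIV. (m $ i) *s axis i 1)"
    by simp
  then show ?thesis
    by (simp add: sum scale)
qed

lemma finite_rvec_ball:
  "finite {m :: int ^ 'g::finite. norm (rvec m) \<le> R}"
proof (rule finite_subset)
  let ?S = "PiE (UNIV :: 'g set) (\<lambda>_. {- \<lceil>\<bar>R\<bar>\<rceil>..\<lceil>\<bar>R\<bar>\<rceil>})"
  show "{m :: int ^ 'g. norm (rvec m) \<le> R} \<subseteq> (\<lambda>f. \<chi> i. f i) ` ?S"
  proof
    fix m :: "int ^ 'g"
    assume "m \<in> {m. norm (rvec m) \<le> R}"
    then have *: "norm (rvec m) \<le> R" by simp
    have "\<bar>real_of_int (m $ i)\<bar> \<le> \<bar>R\<bar>" for i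
      using component_le_norm_cart[of "rvec m" i] * by (simp add: rvec_def)
    then have "m $ i \<in> {- \<lceil>\<bar>R\<bar>\<rceil>..\<lceil>\<bar>R\<bar>\<rceil>}" for i
      by (smt (verit) atLeastAtMost_iff le_of_int_ceiling of_int_le_iff of_int_minus abs_le_iff)
    then have "(\<lambda>i. m $ i) \<in> ?S"
      by auto
    then show "m \<in> (\<lambda>f. \<chi> i. f i) ` ?S"
      by (intro image_eqI[of _ _ "\<lambda>i. m $ i"]) simp_all
  qed
qed (intro finite_imageI finite_PiE; simp)

text \<open>Coordinatewise rounding. The constant is crude; what matters is that it does not depend
  on \<open>y\<close>, since it is the source of the constant in the final estimate.\<close>

lemma rvec_rounding:
  fixes y :: "real ^ 'g::finite"
  obtains m where "norm (rvec m - y) \<le> real CARD('g)"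
proof
  let ?m = "(\<chi> i. round (y $ i)) :: int ^ 'g"
  have "norm (rvec ?m - y) \<le> (\<Sum>i\<in>UNIV. \<bar>(rvec ?m - y) $ i\<bar>)"
    by (rule norm_le_l1_cart)
  also have "\<dots> \<le> (\<Sum>i\<in>(UNIV :: 'g set). 1)"
  proof (rule sum_mono)
    fix i
    show "\<bar>(rvec ?m - y) $ i\<bar> \<le> 1"
      using of_int_round_abs_le[of "y $ i"] by (simp add: rvec_def)
  qed
  finally show "norm (rvec ?m - y) \<le> real CARD('g)"
    by simp
qed


section \<open>Legendre transforms of quadratic forms\<close>

text \<open>A finite supremum of affine functions is convex, and a convex function on a whole
  Euclidean space is continuous. This covers the real and the discrete Legendre transform at
  once.\<close>

lemma continuous_on_SUP_affine:
  fixes p :: "'i \<Rightarrow> 'a::euclidean_space"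
  assumes bdd: "\<And>n. bdd_above (range (\<lambda>i. p i \<bullet> n - c i))"
  shows "continuous_on UNIV (\<lambda>n. SUP i. p i \<bullet> n - c i)"
proof (rule convex_on_continuous[OF open_UNIV], rule convex_onI)
  let ?f = "\<lambda>n. SUP i. p i \<bullet> n - c i"
  fix t :: real and x y :: 'a
  assume t: "0 < t" "t < 1"
  show "?f ((1 - t) *\<^sub>R x + t *\<^sub>R y) \<le> (1 - t) * ?f x + t * ?f y"
  proof (rule cSUP_least)
    fix i
    have "p i \<bullet> ((1 - t) *\<^sub>R x + t *\<^sub>R y) - c i
        = (1 - t) * (p i \<bullet> x - c i) + t * (p i \<bullet> y - c i)"
      by (simp add: inner_add_right algebra_simps)
    also have "\<dots> \<le> (1 - t) * ?f x + t * ?f y"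
      using t by (intro add_mono mult_left_mono cSUP_upper bdd) auto
    finally show "p i \<bullet> ((1 - t) *\<^sub>R x + t *\<^sub>R y) - c i \<le> (1 - t) * ?f x + t * ?f y" .
  qed simp
qed simp

text \<open>If \<open>B z z = 0\<close>, the form is affine in \<open>t\<close> along
  \<open>t z + y\<close>. With a nonzero slope it would take the value -1, and \<open>t\<close> is
  solved for accordingly.\<close>

lemma semidefinite_radical:
  assumes B: "bilinear B" and sym: "\<And>x y. B x y = B y x"
    and psd: "\<And>x. B x x \<ge> (0::real)" and z: "B z z = 0"
  shows "B z y = 0"
proof (rule ccontr)
  assume nz: "B z y \<noteq> 0"
  define t where "t = - (B y y + 1) / (2 * B z y)"
  have "B (t *\<^sub>R z + y) (t *\<^sub>R z + y) = 2 * t * B z y + B y y"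
    by (simp add: bilinear_ladd[OF B] bilinear_radd[OF B] bilinear_lmul[OF B]
        bilinear_rmul[OF B] z sym[of y z])
  also have "\<dots> = -1"
    using nz by (simp add: t_def)
  finally show False
    using psd[of "t *\<^sub>R z + y"] by simp
qed

text \<open>A nonzero real vector in the radical would have multiples arbitrarily close to the lattice,
  by Dirichlet's theorem, and so give lattice vectors on which the form is arbitrarily small.\<close>

lemma bilinear_pos_if_pos_on_lattice:
  fixes B :: "real ^ 'g::finite \<Rightarrow> real ^ 'g \<Rightarrow> real"
  assumes B: "bilinear B" and sym: "\<And>x y. B x y = B y x"
    and d: "d > 0" and lat: "\<And>m. m \<noteq> 0 \<Longrightarrow> B (rvec m) (rvec m) \<ge> d"
    and y: "y \<noteq> 0"
  shows "B y y > 0"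
proof -
  obtain C where C: "C > 0" "\<And>x y. \<bar>B x y\<bar> \<le> C * norm x * norm y"
    using bilinear_bounded_pos[OF B] by auto
  note bil = bilinear_ladd[OF B] bilinear_radd[OF B] bilinear_lmul[OF B] bilinear_rmul[OF B]
    bilinear_lsub[OF B] bilinear_rsub[OF B]
  have lat0: "B (rvec m) (rvec m) \<ge> 0" for m
    using lat[of m] d by (cases "m = 0") (auto simp: bilinear_lzero[OF B])
  \<comment> \<open>Rounding \<open>s y\<close> to the lattice changes the form by O(s) only,
    whereas a negative \<open>B y y\<close> would contribute a negative term of order
    \<open>s^2\<close>.\<close>
  have psd: "B y y \<ge> 0" for y
  proof (rule ccontr)
    assume neg: "\<not> B y y \<ge> 0"
    define R where "R = real CARD('g)"
    have R: "R \<ge> 0" by (simp add: R_def)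
    have bound: "s * - B y y \<le> C * R * (2 * norm y + R)" if s: "s \<ge> 1" for s
    proof -
      obtain m :: "int ^ 'g" where m: "norm (rvec m - s *\<^sub>R y) \<le> R"
        unfolding R_def by (rule rvec_rounding)
      define e where "e = rvec m - s *\<^sub>R y"
      have "rvec m = s *\<^sub>R y + e"
        by (simp add: e_def)
      then have "0 \<le> B (s *\<^sub>R y + e) (s *\<^sub>R y + e)"
        using lat0[of m] by simp
      also have "\<dots> = s * s * B y y + 2 * s * B y e + B e e"
        by (simp add: bil sym[of e y] algebra_simps)
      \<comment> \<open>The constant term is inflated by \<open>s \<ge> 1\<close> so that a common
        factor \<open>s\<close> can be cancelled.\<close>
      also have "\<dots> \<le> s * s * B y y + 2 * s * (C * norm y * R) + s * (C * R * R)"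
      proof -
        have "B y e \<le> C * norm y * norm e" "B e e \<le> C * norm e * norm e"
          using C(2)[of y e] C(2)[of e e] by auto
        moreover have "C * norm y * norm e \<le> C * norm y * R"
          using m C(1) by (intro mult_left_mono) (auto simp: e_def)
        moreover have "C * norm e * norm e \<le> C * R * R"
          using m C(1) R by (intro mult_mono) (auto simp: e_def)
        moreover have "C * R * R \<le> s * (C * R * R)"
          using mult_right_mono[of 1 s "C * R * R"] s C(1) R by simp
        ultimately show ?thesis
          using s by (intro add_mono) (auto intro!: mult_left_mono)
      qed
      finally have "s * (s * - B y y) \<le> s * (C * R * (2 * norm y + R))"
        by (simp add: algebra_simps)
      then show ?thesis
        using s by (metis less_le_trans mult_le_cancel_left_pos zero_less_one)
    qed
    define s where "s = max 1 ((C * R * (2 * norm y + R) + 1) / - B y y)"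
    have "s * - B y y \<ge> C * R * (2 * norm y + R) + 1"
      using neg mult_right_mono[of "(C * R * (2 * norm y + R) + 1) / - B y y" s "- B y y"]
      by (simp add: s_def)
    then show False
      using bound[of s] by (simp add: s_def)
  qed
  show ?thesis
  proof (rule ccontr)
    assume "\<not> B y y > 0"
    then have y0: "B y y = 0"
      using psd[of y] by simp
    note rad = semidefinite_radical[OF B sym psd y0]
    define w where "w = (1 / norm y) *\<^sub>R y"
    have w1: "norm w = 1"
      using y by (simp add: w_def)
    have radw: "B w z = 0" for z
      by (simp add: w_def bil rad)
    define G where "G = real CARD('g)"
    have G: "G \<ge> 1"
      by (simp add: G_def Suc_leI)
    \<comment> \<open>\<open>N > G\<close> keeps the approximation error below 1; as
      \<open>q w\<close> has norm \<open>q \<ge> 1\<close>, the approximating lattice vector is then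
      nonzero. The other bound on \<open>N\<close> pushes the value of the form on the error below
      \<open>d\<close>.\<close>
    obtain N :: nat where N: "N > G" "N > C * G * G / d"
      using reals_Archimedean2[of "max G (C * G * G / d)"] by auto
    have N0: "N > 0"
      using N(1) G by (cases N) auto
    obtain f :: "'g \<Rightarrow> nat" where f: "bij_betw f UNIV {0..<CARD('g)}"
      using ex_bij_betw_finite_nat[of "UNIV :: 'g set"] by auto
    obtain q p where q: "0 < q" and "q \<le> int (N ^ CARD('g))" and
      p: "\<And>i. i < CARD('g) \<Longrightarrow> \<bar>of_int q * w $ inv_into UNIV f i - of_int (p i)\<bar> < 1 / N"
      by (rule Dirichlet_approx_simult[OF N0, where n = "CARD('g)"
          and \<theta> = "\<lambda>i. w $ inv_into UNIV f i"]) blast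
    define m :: "int ^ 'g" where "m = (\<chi> i. p (f i))"
    define e where "e = rvec m - of_int q *\<^sub>R w"
    have finv: "inv_into UNIV f (f i) = i" for i
      using f by (simp add: bij_betw_def)
    have flt: "f i < CARD('g)" for i
      using f by (auto simp: bij_betw_def)
    have "\<bar>e $ i\<bar> \<le> 1 / N" for i
      using p[OF flt, of i] by (simp add: finv e_def m_def rvec_def)
    then have "(\<Sum>i\<in>UNIV. \<bar>e $ i\<bar>) \<le> (\<Sum>i\<in>(UNIV :: 'g set). 1 / N)"
      by (intro sum_mono) auto
    then have e: "norm e \<le> G / N"
      using norm_le_l1_cart[of e] by (simp add: G_def)
    have "G / N < 1"
      using N(1) N0 by (simp add: field_simps)
    have "m \<noteq> 0"
    proof
      assume "m = 0"
      then have "norm e = of_int q"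
        using q w1 by (simp add: e_def)
      then show False
        using e \<open>G / N < 1\<close> q by simp
    qed
    then have "d \<le> B (rvec m) (rvec m)"
      by (rule lat)
    also have "rvec m = of_int q *\<^sub>R w + e"
      by (simp add: e_def)
    also have "B (of_int q *\<^sub>R w + e) (of_int q *\<^sub>R w + e) = B e e"
      by (simp add: bil radw sym[of e w])
    also have "\<dots> \<le> C * norm e * norm e"
      using C(2)[of e e] by simp
    also have "\<dots> \<le> C * (G / N) * 1"
      using e \<open>G / N < 1\<close> C(1) G by (intro mult_mono) auto
    also have "\<dots> \<le> C * G * G / N"
      using C(1) G N0 by (simp add: field_simps)
    also have "\<dots> < d"
      using N(2) d N0 by (simp add: field_simps)
    finally show False
      by simp
  qed
qed

section \<open>Positive definite forms and their Legendre transforms\<close>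

locale pos_def_form =
  fixes B :: "real ^ 'g::finite \<Rightarrow> real ^ 'g \<Rightarrow> real"
  assumes bil: "bilinear B"
    and sym: "B x y = B y x"
    and pos: "x \<noteq> 0 \<Longrightarrow> B x x > 0"
begin

lemmas B_simps = bilinear_ladd[OF bil] bilinear_radd[OF bil] bilinear_lmul[OF bil]
  bilinear_rmul[OF bil] bilinear_lsub[OF bil] bilinear_rsub[OF bil] bilinear_lneg[OF bil]
  bilinear_rneg[OF bil] bilinear_lzero[OF bil] bilinear_rzero[OF bil]

lemma nonneg: "B x x \<ge> 0"
  using pos[of x] by (cases "x = 0") (auto simp: B_simps)

lemma coercive:
  obtains c where "c > 0" "\<And>x. c * norm x ^ 2 \<le> B x x"
proof -
  have cont: "continuous_on (sphere 0 1) (\<lambda>x. B x x)"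
    by (rule bilinear_continuous_on_compose[OF continuous_on_id continuous_on_id bil])
  have "sphere 0 1 \<noteq> ({} :: (real ^ 'g) set)"
    by simp
  then obtain w where w: "w \<in> sphere 0 1" "\<And>x. x \<in> sphere 0 1 \<Longrightarrow> B w w \<le> B x x"
    using continuous_attains_inf[OF compact_sphere _ cont] by blast
  have "B w w * norm x ^ 2 \<le> B x x" for x
  proof (cases "x = 0")
    case False
    let ?u = "(1 / norm x) *\<^sub>R x"
    have "B w w \<le> B ?u ?u"
      using False by (intro w(2)) simp
    then show ?thesis
      using False by (simp add: B_simps field_simps power2_eq_square)
  qed (simp add: B_simps)
  moreover have "B w w > 0"
    using w(1) by (intro pos) auto
  ultimately show thesis
    using that by blast
qed

lemma form_eq_inner: "B u y = (\<chi> i. B u (axis i 1)) \<bullet> y"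
proof -
  have "B u y = B u (\<Sum>i\<in>UNIV. (y $ i) *\<^sub>R axis i 1)"
    using basis_expansion[of y] by (simp add: scalar_mult_eq_scaleR)
  also have "\<dots> = (\<Sum>i\<in>UNIV. y $ i * B u (axis i 1))"
    using bil by (simp add: bilinear_def linear_sum B_simps linear_cmul)
  finally show ?thesis
    by (simp add: inner_vec_def mult.commute)
qed

text \<open>The vector \<open>u\<close> is the point where
  \<open>m \<bullet> n - 1 / 2 * B m m\<close> is largest; the estimates below measure distances
  from it.\<close>

lemma riesz:
  obtains u where "\<And>y. B u y = n \<bullet> y"
proof -
  define T where "T u = (\<chi> i. B u (axis i 1))" for u
  have lin: "linear T"
    by (rule linearI) (simp_all add: T_def vec_eq_iff B_simps)
  have T: "B u y = T u \<bullet> y" for u y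
    unfolding T_def by (rule form_eq_inner)
  have "inj T"
    unfolding linear_injective_0[OF lin]
  proof (intro allI impI)
    fix u assume "T u = 0"
    then have "B u u = 0" by (simp add: T)
    then show "u = 0" using pos[of u] by fastforce
  qed
  then have "surj T"
    using lin by (intro linear_injective_imp_surjective) simp_all
  then show thesis
    using that T by (metis surjD)
qed

definition legendre :: "real ^ 'g \<Rightarrow> real" where
  "legendre n = (SUP m. m \<bullet> n - 1 / 2 * B m m)"

lemma complete_square:
  assumes "\<And>y. B u y = n \<bullet> y"
  shows "m \<bullet> n - 1 / 2 * B m m = B u u / 2 - B (m - u) (m - u) / 2"
  using assms[of m] by (simp add: B_simps sym[of m u] inner_commute diff_divide_distrib add_divide_distrib)

lemma legendre_bdd: "bdd_above (range (\<lambda>m. m \<bullet> n - 1 / 2 * B m m))"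
proof -
  obtain u where u: "\<And>y. B u y = n \<bullet> y"
    using riesz by blast
  show ?thesis
    unfolding complete_square[OF u] by (rule bdd_aboveI[of _ "B u u / 2"]) (auto simp: nonneg)
qed

lemma legendre_eq:
  assumes u: "\<And>y. B u y = n \<bullet> y"
  shows "legendre n = B u u / 2"
proof (rule antisym)
  show "legendre n \<le> B u u / 2"
    unfolding legendre_def complete_square[OF u] by (rule cSUP_least) (auto simp: nonneg)
  show "B u u / 2 \<le> legendre n"
    using cSUP_upper[OF UNIV_I legendre_bdd, of u n]
    unfolding legendre_def complete_square[OF u] by (simp add: B_simps)
qed

lemma continuous_legendre: "continuous_on UNIV legendre"
  unfolding legendre_def[abs_def] by (rule continuous_on_SUP_affine[OF legendre_bdd])

text \<open>The maximizer moves from \<open>u\<close> to \<open>u + w\<close>. For \<open>w\<close>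
  in the image of \<open>\<Phi>\<close> and \<open>t\<close> the tropicalization of the
  corresponding period, this is the descent condition in \<open>metrics\<close>.\<close>

lemma legendre_shift:
  assumes t: "\<And>y. B w y = t \<bullet> y"
  shows "legendre (n + t) = legendre n + w \<bullet> n + B w w / 2"
proof -
  obtain u where u: "\<And>y. B u y = n \<bullet> y"
    using riesz by blast
  have "B (u + w) y = (n + t) \<bullet> y" for y
    by (simp add: B_simps u t inner_add_left)
  from legendre_eq[OF this] legendre_eq[OF u] u[of w] show ?thesis
    by (simp add: B_simps sym[of w u] inner_commute)
qed

text \<open>The discrete Legendre transform, over \<open>(1/k) M\<close>: the maximum of \<open>lattice_term k n\<close>
  divided by \<open>k\<close> is that of \<open>- \<langle>y, n\<rangle> - B(y, y) / 2\<close> for \<open>y\<close> in \<open>(1/k) M\<close>.\<close>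

definition lattice_term :: "nat \<Rightarrow> real ^ 'g \<Rightarrow> int ^ 'g \<Rightarrow> real" where
  "lattice_term k n m = - (rvec m \<bullet> n) - B (rvec m) (rvec m) / (2 * real k)"

definition lattice_legendre :: "nat \<Rightarrow> real ^ 'g \<Rightarrow> real" where
  "lattice_legendre k n = 1 / real k * (SUP m. lattice_term k n m)"

text \<open>The quadratic part outgrows the linear one. This gives both the existence of a
  maximizing character and the convergence of the theta series. The radius \<open>R\<close> is where
  \<open>c r / (2 k)\<close> overtakes \<open>norm n + \<bar>T\<bar> + 1\<close>; being at least 1,
  it also allows multiplication by \<open>r\<close>.\<close>

lemma finite_lattice_term_superlevel:
  assumes k: "k > 0"
  shows "finite {m. lattice_term k n m \<ge> T}"
proof -
  obtain c where c: "c > 0" "\<And>x. c * norm x ^ 2 \<le> B x x"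
    using coercive by blast
  define R where "R = max 1 (2 * real k * (norm n + \<bar>T\<bar> + 1) / c)"
  have "norm (rvec m) \<le> R" if T: "lattice_term k n m \<ge> T" for m
  proof (rule ccontr)
    let ?r = "norm (rvec m)"
    assume "\<not> ?r \<le> R"
    then have r: "?r > 1" "?r > 2 * real k * (norm n + \<bar>T\<bar> + 1) / c"
      by (auto simp: R_def)
    then have "norm n + \<bar>T\<bar> + 1 < c * ?r / (2 * real k)"
      using c(1) k by (simp add: field_simps)
    then have "\<bar>T\<bar> + 1 \<le> c * ?r / (2 * real k) - norm n"
      by simp
    then have "1 * (\<bar>T\<bar> + 1) \<le> ?r * (c * ?r / (2 * real k) - norm n)"
      using r(1) by (intro mult_mono) auto
    also have "\<dots> = c * ?r ^ 2 / (2 * real k) - ?r * norm n"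
      by (simp add: algebra_simps power2_eq_square)
    also have "\<dots> \<le> B (rvec m) (rvec m) / (2 * real k) + rvec m \<bullet> n"
    proof -
      have "c * ?r ^ 2 / (2 * real k) \<le> B (rvec m) (rvec m) / (2 * real k)"
        using c(2)[of "rvec m"] by (intro divide_right_mono) auto
      moreover have "- (rvec m \<bullet> n) \<le> ?r * norm n"
        using Cauchy_Schwarz_ineq2[of "rvec m" n] by simp
      ultimately show ?thesis by simp
    qed
    finally show False
      using T by (simp add: lattice_term_def)
  qed
  then show ?thesis
    by (auto intro: finite_subset[OF _ finite_rvec_ball[of R]])
qed

lemma lattice_term_max:
  assumes k: "k > 0"
  obtains m0 where "\<And>m. lattice_term k n m \<le> lattice_term k n m0"
proof -
  let ?S = "{m. lattice_term k n m \<ge> lattice_term k n 0}"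
  have fin: "finite ?S"
    by (rule finite_lattice_term_superlevel[OF k])
  have "?S \<noteq> {}"
    by blast
  with fin have "Max (lattice_term k n ` ?S) \<in> lattice_term k n ` ?S"
    using Max_in[of "lattice_term k n ` ?S"] by blast
  then obtain m0 where m0: "m0 \<in> ?S" "Max (lattice_term k n ` ?S) = lattice_term k n m0"
    by (rule imageE)
  have "lattice_term k n m \<le> lattice_term k n m0" for m
  proof (cases "m \<in> ?S")
    case True
    then show ?thesis
      using fin unfolding m0(2)[symmetric] by (intro Max_ge finite_imageI imageI)
  next
    case False
    then show ?thesis using m0(1) by simp
  qed
  then show thesis
    using that by blast
qed

text \<open>A quadratic polynomial in \<open>j\<close>. The case \<open>j = k\<close> is a shift by
  \<open>k w\<close>, under which the discrete transform is reindexed; \<open>j = 1\<close> gives a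
  lattice point in between.\<close>

lemma lattice_term_add:
  assumes k: "k > 0"
  shows "lattice_term k n (m + int j *s w) = lattice_term k n m
    - real j * (rvec w \<bullet> n + B (rvec w) (rvec m) / real k)
    - real j ^ 2 * B (rvec w) (rvec w) / (2 * real k)"
proof -
  have eq: "B (rvec m + real j *\<^sub>R rvec w) (rvec m + real j *\<^sub>R rvec w) = B (rvec m) (rvec m)
      + 2 * real j * B (rvec w) (rvec m) + real j ^ 2 * B (rvec w) (rvec w)"
    by (simp add: B_simps sym[of "rvec m" "rvec w"] power2_eq_square) (simp add: algebra_simps)
  show ?thesis
    unfolding lattice_term_def rvec_add rvec_scale eq inner_add_left inner_scaleR_left
    using k by (simp add: add_divide_distrib) (simp add: algebra_simps)
qed

lemma lattice_term_bdd: "k > 0 \<Longrightarrow> bdd_above (range (lattice_term k n))"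
  by (rule lattice_term_max[of k n]) (assumption, rule bdd_aboveI2)

lemma lattice_legendre_eq:
  assumes "\<And>m. lattice_term k n m \<le> lattice_term k n m0"
  shows "lattice_legendre k n = 1 / real k * lattice_term k n m0"
proof -
  have "(SUP m. lattice_term k n m) = lattice_term k n m0"
    by (rule cSup_eq_maximum) (use assms in auto)
  then show ?thesis
    by (simp add: lattice_legendre_def)
qed

lemma exp_lattice_term_tendsto_0:
  assumes k: "k > 0"
  shows "((\<lambda>m. exp (lattice_term k n m)) \<longlongrightarrow> 0) cofinite"
proof (rule order_tendstoI)
  fix e :: real assume e: "0 < e"
  have "e \<le> exp x \<longleftrightarrow> ln e \<le> x" for x
    using exp_le_cancel_iff[of "ln e" x] e by simp
  then have "{m. \<not> exp (lattice_term k n m) < e} = {m. lattice_term k n m \<ge> ln e}"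
    by (simp add: not_less)
  then show "\<forall>\<^sub>F m in cofinite. exp (lattice_term k n m) < e"
    using finite_lattice_term_superlevel[OF k, of "ln e" n] by (simp add: eventually_cofinite)
qed (auto intro: always_eventually less_trans[OF _ exp_gt_zero])

lemma continuous_lattice_legendre:
  assumes k: "k > 0"
  shows "continuous_on UNIV (lattice_legendre k)"
proof -
  have eq: "lattice_term k n m = (- rvec m) \<bullet> n - B (rvec m) (rvec m) / (2 * real k)" for n m
    by (simp add: lattice_term_def)
  show ?thesis
    unfolding lattice_legendre_def[abs_def] eq
    by (intro continuous_intros continuous_on_SUP_affine)
      (use lattice_term_bdd[OF k] in \<open>simp add: eq\<close>)
qed

text \<open>Unlike in the real case \<open>w\<close> has to be a lattice vector: moving
  \<open>n\<close> by \<open>t\<close> amounts to reindexing by \<open>m + k w\<close>, which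
  permutes M, and adds a constant to all terms.\<close>

lemma lattice_legendre_shift:
  assumes k: "k > 0" and t: "\<And>y. B (rvec w) y = t \<bullet> y"
  shows "lattice_legendre k (n + t) = lattice_legendre k n + rvec w \<bullet> n + B (rvec w) (rvec w) / 2"
proof -
  let ?c = "real k * (rvec w \<bullet> n + B (rvec w) (rvec w) / 2)"
  have shift: "lattice_term k (n + t) m = lattice_term k n (m + int k *s w) + ?c" for m
  proof -
    have "rvec m \<bullet> t = B (rvec w) (rvec m)"
      by (simp add: t inner_commute)
    then have "lattice_term k (n + t) m = lattice_term k n m - B (rvec w) (rvec m)"
      by (simp add: lattice_term_def inner_add_right)
    moreover have "real k * (x + y / real k) = real k * x + y" for x y
      using k by (simp add: distrib_left)
    moreover have "real k ^ 2 * x / (2 * real k) = real k * (x / 2)" for x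
      using k by (simp add: power2_eq_square)
    ultimately show ?thesis
      unfolding lattice_term_add[OF k] by (simp add: distrib_left)
  qed
  obtain m0 where m0: "\<And>m. lattice_term k n m \<le> lattice_term k n m0"
    using lattice_term_max[OF k] by blast
  have "lattice_term k (n + t) m \<le> lattice_term k (n + t) (m0 - int k *s w)" for m
    using m0 by (simp add: shift)
  then have "lattice_legendre k (n + t) = 1 / real k * (lattice_term k n m0 + ?c)"
    by (simp add: lattice_legendre_eq[of k "n + t" "m0 - int k *s w"] shift)
  moreover have "1 / real k * (x + real k * y) = 1 / real k * x + y" for x y
    using k by (simp add: distrib_left)
  ultimately show ?thesis
    by (simp only: lattice_legendre_eq[OF m0] add.assoc)
qed

lemma legendre_minus_lattice_legendre:
  obtains C where "\<And>k n. k > 0 \<Longrightarrow> \<bar>legendre n - lattice_legendre k n\<bar> \<le> C / real k ^ 2"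
proof -
  obtain C where C: "C > 0" "\<And>x y. \<bar>B x y\<bar> \<le> C * norm x * norm y"
    using bilinear_bounded_pos[OF bil] by auto
  define D where "D = C * real CARD('g) * real CARD('g) / 2"
  have "\<bar>legendre n - lattice_legendre k n\<bar> \<le> D / real k ^ 2" if k: "k > 0" for k n
  proof -
    obtain u where u: "\<And>y. B u y = n \<bullet> y"
      using riesz by blast
    \<comment> \<open>The real maximizer of the term at level \<open>k\<close> is
      \<open>- k u\<close>, and \<open>e m\<close> is the deviation from it. Working with
      \<open>m\<close> instead of \<open>m / k\<close> is what produces the factor
      \<open>1 / k^2\<close>.\<close>
    define e where "e m = rvec m + real k *\<^sub>R u" for m
    have "lattice_term k n m / real k = B u u / 2 - B (e m) (e m) / (2 * real k ^ 2)" for m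
    proof -
      have "B (e m) (e m) = B (rvec m) (rvec m) + 2 * real k * (rvec m \<bullet> n) + real k ^ 2 * B u u"
        by (simp add: e_def B_simps sym[of "rvec m" u] u inner_commute[of n] power2_eq_square)
          (simp add: algebra_simps)
      then show ?thesis
        using k by (simp add: lattice_term_def field_simps power2_eq_square)
    qed
    then have diff: "legendre n - lattice_term k n m / real k = B (e m) (e m) / (2 * real k ^ 2)"
      for m
      by (simp add: legendre_eq[OF u])
    obtain m0 where m0: "\<And>m. lattice_term k n m \<le> lattice_term k n m0"
      using lattice_term_max[OF k] by blast
    \<comment> \<open>A lattice point near \<open>- k u\<close> need not be the maximizer, but it
      bounds the defect of the maximizer from above, uniformly in \<open>n\<close> and
      \<open>k\<close>.\<close>
    obtain m1 :: "int ^ 'g" where "norm (rvec m1 - (- real k *\<^sub>R u)) \<le> real CARD('g)"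
      by (rule rvec_rounding)
    then have m1: "norm (e m1) \<le> real CARD('g)"
      by (simp add: e_def)
    have ll: "lattice_legendre k n = lattice_term k n m0 / real k"
      by (simp add: lattice_legendre_eq[OF m0])
    have "0 \<le> legendre n - lattice_legendre k n"
      unfolding ll diff by (simp add: nonneg)
    moreover have "legendre n - lattice_legendre k n \<le> legendre n - lattice_term k n m1 / real k"
      unfolding ll using m0[of m1] k by (simp add: divide_right_mono)
    moreover have "B (e m1) (e m1) \<le> C * real CARD('g) * real CARD('g)"
    proof -
      have "B (e m1) (e m1) \<le> C * norm (e m1) * norm (e m1)"
        using C(2)[of "e m1" "e m1"] by simp
      also have "\<dots> \<le> C * real CARD('g) * real CARD('g)"
        using m1 C(1) by (intro mult_mono) auto
      finally show ?thesis .
    qed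
    then have "legendre n - lattice_term k n m1 / real k \<le> D / real k ^ 2"
      unfolding diff D_def using k by (simp add: field_simps)
    ultimately show ?thesis
      by simp
  qed
  then show thesis
    using that by blast
qed

text \<open>Along the segment from \<open>m\<close> to \<open>m + k w\<close> the term is strictly concave, and \<open>m + w\<close> is an
  interior lattice point of it when \<open>k \<ge> 2\<close>.\<close>

lemma lattice_term_max_unique_mod:
  assumes k: "k \<ge> 2" and m0: "\<And>m. lattice_term k n m \<le> lattice_term k n m0"
    and w: "w \<noteq> 0"
  shows "lattice_term k n (m0 + int k *s w) < lattice_term k n m0"
proof (rule ccontr)
  assume not_less: "\<not> ?thesis"
  define W where "W = B (rvec w) (rvec w)"
  define \<alpha> where "\<alpha> = rvec w \<bullet> n + B (rvec w) (rvec m0) / real k"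
  have W: "W > 0"
    using w by (simp add: W_def pos)
  have along: "lattice_term k n (m0 + int j *s w)
      = lattice_term k n m0 - real j * \<alpha> - real j ^ 2 * W / (2 * real k)" for j
    using k by (simp add: lattice_term_add W_def \<alpha>_def)
  \<comment> \<open>The failed inequality at \<open>j = k\<close> gives
    \<open>\<alpha> \<le> - W / 2\<close>; maximality at \<open>j = 1\<close> gives
    \<open>\<alpha> \<ge> - W / (2 * real k)\<close>. These are incompatible as soon as
    \<open>k > 1\<close>.\<close>
  have "real k ^ 2 * W / (2 * real k) = real k * (W / 2)"
    using k by (simp add: power2_eq_square)
  then have "real k * (\<alpha> + W / 2) \<le> 0"
    using not_less along[of k] by (simp add: distrib_left)
  then have "\<alpha> \<le> - W / 2"
    using k by (simp add: mult_le_0_iff)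
  moreover have "0 \<le> \<alpha> + W / (2 * real k)"
    using m0[of "m0 + int 1 *s w"] along[of 1] by simp
  moreover have "W / (2 * real k) < W / 2"
    using W k by (simp add: field_simps)
  ultimately show False
    by simp
qed

end

section \<open>The absolute value on \<open>K\<close>\<close>

lemma absK_0 [simp]: "absK 0 = 0"
  by (simp add: absK_def)

lemma absK_1 [simp]: "absK 1 = 1"
  by (simp add: absK_def)

lemma absK_nonneg: "absK f \<ge> 0"
  by (simp add: absK_def)

lemma absK_pos: "f \<noteq> 0 \<Longrightarrow> absK f > 0"
  by (simp add: absK_def)

lemma absK_mult: "absK (f * g) = absK f * absK g"
  by (simp add: absK_def exp_add[symmetric])

lemma absK_uminus: "absK (- f) = absK f"
proof -
  have "absK (- 1) * absK (- 1) = 1"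
    by (simp flip: absK_mult)
  then have "(absK (- 1))\<^sup>2 = 1"
    by (simp add: power2_eq_square)
  then have "absK (- 1) = 1"
    using absK_nonneg[of "- 1"] by (simp add: power2_eq_1_iff)
  then show ?thesis
    using absK_mult[of "- 1" f] by simp
qed

lemma absK_add: "absK (f + g) \<le> max (absK f) (absK g)"
proof (cases "f = 0 \<or> g = 0 \<or> f + g = 0")
  case True
  then show ?thesis
    using absK_nonneg[of f] absK_nonneg[of g] by (auto simp: le_max_iff_disj)
next
  case False
  then show ?thesis
    using fls_plus_subdegree[of f g] by (auto simp: absK_def le_max_iff_disj min_def split: if_splits)
qed

lemma ln_absK: "f \<noteq> 0 \<Longrightarrow> - ln (absK f) = of_int (fls_subdegree f)"
  by (simp add: absK_def)


section \<open>Homomorphisms out of the group ring\<close>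

text \<open>One construction for two kinds of homomorphism: translation by a period, and evaluation
  at the unit of the torus.\<close>

definition keys_sum :: "('m \<Rightarrow> 'c::zero \<Rightarrow> 'r::comm_monoid_add) \<Rightarrow> ('m \<Rightarrow>\<^sub>0 'c) \<Rightarrow> 'r" where
  "keys_sum F f = (\<Sum>m\<in>Poly_Mapping.keys f. F m (Poly_Mapping.lookup f m))"

lemma keys_sum_superset:
  assumes "\<And>m. F m 0 = 0" and "finite A" "Poly_Mapping.keys f \<subseteq> A"
  shows "keys_sum F f = (\<Sum>m\<in>A. F m (Poly_Mapping.lookup f m))"
  unfolding keys_sum_def
  by (rule sum.mono_neutral_left) (use assms in \<open>auto simp: in_keys_iff\<close>)

lemma keys_sum_single:
  assumes "\<And>m. F m 0 = 0"
  shows "keys_sum F (Poly_Mapping.single m c) = F m c"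
  using keys_sum_superset[of F "{m}" "Poly_Mapping.single m c"] assms by simp

lemma keys_sum_add:
  assumes F0: "\<And>m. F m 0 = 0" and add: "\<And>m c d. F m (c + d) = F m c + F m d"
  shows "keys_sum F (f + g) = keys_sum F f + keys_sum F g"
proof -
  let ?A = "Poly_Mapping.keys f \<union> Poly_Mapping.keys g"
  have "keys_sum F h = (\<Sum>m\<in>?A. F m (Poly_Mapping.lookup h m))"
    if "Poly_Mapping.keys h \<subseteq> ?A" for h
    by (rule keys_sum_superset) (use F0 that in auto)
  then show ?thesis
    using keys_add[of f g] by (simp add: lookup_add add sum.distrib)
qed

lemma poly_mapping_eq_sum_single:
  "f = (\<Sum>m\<in>Poly_Mapping.keys f. Poly_Mapping.single m (Poly_Mapping.lookup f m))"
proof (rule poly_mapping_eqI)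
  fix n
  show "Poly_Mapping.lookup f n = Poly_Mapping.lookup
      (\<Sum>m\<in>Poly_Mapping.keys f. Poly_Mapping.single m (Poly_Mapping.lookup f m)) n"
    by (simp add: lookup_sum lookup_single when_def sum.delta in_keys_iff)
qed

lemma keys_sum_mult:
  fixes F :: "'m::monoid_add \<Rightarrow> 'c::comm_semiring_0 \<Rightarrow> 'r::comm_semiring_0"
  assumes F0: "\<And>m. F m 0 = 0" and add: "\<And>m c d. F m (c + d) = F m c + F m d"
    and mult: "\<And>m n c d. F (m + n) (c * d) = F m c * F n d"
  shows "keys_sum F (f * g) = keys_sum F f * keys_sum F g"
proof -
  let ?L = "Poly_Mapping.lookup"
  have zero: "keys_sum F 0 = 0"
    by (simp add: keys_sum_def)
  have sum: "keys_sum F (\<Sum>i\<in>I. h i) = (\<Sum>i\<in>I. keys_sum F (h i))" if "finite I" for I :: "'m set" and h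
    using that by induction (simp_all add: zero keys_sum_add[OF F0 add])
  have "f * g = (\<Sum>m\<in>Poly_Mapping.keys f. Poly_Mapping.single m (?L f m))
      * (\<Sum>n\<in>Poly_Mapping.keys g. Poly_Mapping.single n (?L g n))"
    by (metis poly_mapping_eq_sum_single)
  also have "\<dots> = (\<Sum>m\<in>Poly_Mapping.keys f. \<Sum>n\<in>Poly_Mapping.keys g.
      Poly_Mapping.single (m + n) (?L f m * ?L g n))"
    by (simp add: sum_product mult_single)
  finally have "keys_sum F (f * g)
      = (\<Sum>m\<in>Poly_Mapping.keys f. \<Sum>n\<in>Poly_Mapping.keys g. F m (?L f m) * F n (?L g n))"
    by (simp add: sum keys_sum_single[of F, OF F0] mult)
  then show ?thesis
    by (simp add: keys_sum_def sum_product)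
qed


section \<open>Points of the analytic torus\<close>

context
  fixes x :: "('g::finite) point"
  assumes x: "x \<in> Tan"
begin

lemma Tan_nonneg: "x f \<ge> 0"
  and Tan_add: "x (f + h) \<le> max (x f) (x h)"
  and Tan_mult: "x (f * h) = x f * x h"
  and Tan_const: "x (Poly_Mapping.single 0 c) = absK c"
  using x by (simp_all add: Tan_def)

lemma Tan_0: "x 0 = 0"
  using Tan_const[of 0] by simp

lemma Tan_uminus: "x (- f) = x f"
proof -
  have "x (Poly_Mapping.single 0 (- 1) * f) = x f"
    by (simp add: Tan_mult Tan_const absK_uminus)
  moreover have "Poly_Mapping.single 0 (- 1) * f = - f"
    by (simp add: single_uminus)
  ultimately show ?thesis
    by simp
qed

text \<open>The isosceles principle, from \<open>f = (f + h) - h\<close>. All absence of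
  cancellation below rests on it.\<close>

lemma Tan_add_eq:
  assumes "x h < x f"
  shows "x (f + h) = x f"
proof (rule antisym)
  show "x (f + h) \<le> x f"
    using Tan_add[of f h] assms by simp
  have "x f \<le> max (x (f + h)) (x (- h))"
    using Tan_add[of "f + h" "- h"] by simp
  then show "x f \<le> x (f + h)"
    using assms by (simp add: Tan_uminus max_def split: if_splits)
qed

lemma Tan_sum_le:
  assumes "R \<ge> 0" "\<And>m. m \<in> F \<Longrightarrow> x (f m) \<le> R"
  shows "x (\<Sum>m\<in>F. f m) \<le> R"
proof (cases "finite F")
  case True
  then show ?thesis
    using assms(2)
  proof induction
    case (insert m F)
    then show ?case
      using Tan_add[of "f m" "\<Sum>m\<in>F. f m"] by (force simp: max_def split: if_splits)
  qed (use assms(1) in \<open>simp add: Tan_0\<close>)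
qed (use assms(1) in \<open>simp add: Tan_0\<close>)

lemma Tan_sum_less:
  assumes "R > 0" "\<And>m. m \<in> F \<Longrightarrow> x (f m) < R"
  shows "x (\<Sum>m\<in>F. f m) < R"
proof (cases "finite F")
  case True
  then show ?thesis
    using assms(2)
  proof induction
    case (insert m F)
    then show ?case
      using Tan_add[of "f m" "\<Sum>m\<in>F. f m"] by (force simp: max_def split: if_splits)
  qed (use assms(1) in \<open>simp add: Tan_0\<close>)
qed (use assms(1) in \<open>simp add: Tan_0\<close>)

lemma Tan_character_pos: "x (Poly_Mapping.single m 1) > 0"
proof -
  have "x (Poly_Mapping.single m 1) * x (Poly_Mapping.single (- m) 1) = x (Poly_Mapping.single 0 1)"
    by (simp add: mult_single flip: Tan_mult)
  then have "x (Poly_Mapping.single m 1) \<noteq> 0"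
    unfolding Tan_const by auto
  then show ?thesis
    using Tan_nonneg[of "Poly_Mapping.single m 1"] by simp
qed

text \<open>Characters are units, so \<open>- ln\<close> of their values is finite and additive in
  \<open>m\<close>, hence linear in its values on the basis. Monomials therefore see only the
  tropicalization of a point.\<close>

lemma Tan_single: "x (Poly_Mapping.single m c) = absK c * exp (- (rvec m \<bullet> trop x))"
proof -
  have "- ln (x (Poly_Mapping.single (m + m') 1))
      = - ln (x (Poly_Mapping.single m 1)) + - ln (x (Poly_Mapping.single m' 1))" for m m'
  proof -
    have "x (Poly_Mapping.single (m + m') 1)
        = x (Poly_Mapping.single m 1) * x (Poly_Mapping.single m' 1)"
      by (simp add: mult_single flip: Tan_mult)
    then show ?thesis
      using Tan_character_pos[of m] Tan_character_pos[of m'] by (simp add: ln_mult)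
  qed
  from int_vec_expansion[of "\<lambda>m. - ln (x (Poly_Mapping.single m 1))" m, OF this]
  have "- ln (x (Poly_Mapping.single m 1)) = rvec m \<bullet> trop x"
    unfolding trop_def rvec_def inner_vec_def vec_lambda_beta inner_real_def .
  then have "x (Poly_Mapping.single m 1) = exp (- (rvec m \<bullet> trop x))"
    using Tan_character_pos[of m] by (metis exp_ln minus_minus)
  moreover have "x (Poly_Mapping.single m c)
      = x (Poly_Mapping.single 0 c) * x (Poly_Mapping.single m 1)"
    by (simp add: mult_single flip: Tan_mult)
  ultimately show ?thesis
    by (simp add: Tan_const)
qed

text \<open>By the ultrametric inequality the values of the partial sums either become constant or
  tend to 0.\<close>

lemma abs_at_tendsto:
  assumes conv: "((\<lambda>m. x (Poly_Mapping.single m (c m))) \<longlongrightarrow> 0) cofinite"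
  shows "((\<lambda>F. x (\<Sum>m\<in>F. Poly_Mapping.single m (c m))) \<longlongrightarrow> abs_at c x)
    (finite_subsets_at_top UNIV)"
proof -
  let ?S = "\<lambda>F. \<Sum>m\<in>F. Poly_Mapping.single m (c m)"
  have fin: "finite {m. \<not> x (Poly_Mapping.single m (c m)) < e}" if "e > 0" for e
    using order_tendstoD(2)[OF conv that] by (simp add: eventually_cofinite)
  have split: "?S F = ?S G + ?S (F - G)" if "finite F" "G \<subseteq> F" for F G
    using sum.subset_diff[OF that(2,1), of "\<lambda>m. Poly_Mapping.single m (c m)"]
    by (simp add: add.commute)
  \<comment> \<open>For each \<open>e > 0\<close> only finitely many terms have size at least
    \<open>e\<close>. If their sum still has size at least \<open>e\<close>, the remaining terms
    cannot change its value; if this fails for every \<open>e\<close>, the limit is 0.\<close>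
  have "\<exists>L. ((\<lambda>F. x (?S F)) \<longlongrightarrow> L) (finite_subsets_at_top UNIV)"
  proof (cases "\<exists>e>0. e \<le> x (?S {m. \<not> x (Poly_Mapping.single m (c m)) < e})")
    case True
    then obtain e where e: "e > 0" "e \<le> x (?S {m. \<not> x (Poly_Mapping.single m (c m)) < e})"
      by blast
    define G where "G = {m. \<not> x (Poly_Mapping.single m (c m)) < e}"
    have "x (?S F) = x (?S G)" if F: "finite F" "G \<subseteq> F" for F
    proof -
      have "x (?S (F - G)) < e"
        by (rule Tan_sum_less[OF e(1)]) (auto simp: G_def)
      then show ?thesis
        using e(2) unfolding split[OF F] by (intro Tan_add_eq) (simp add: G_def)
    qed
    then have "\<forall>\<^sub>F F in finite_subsets_at_top UNIV. x (?S F) = x (?S G)"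
      using fin[OF e(1), folded G_def] unfolding eventually_finite_subsets_at_top by blast
    then have "((\<lambda>F. x (?S F)) \<longlongrightarrow> x (?S G)) (finite_subsets_at_top UNIV)"
      by (rule tendsto_eventually)
    then show ?thesis ..
  next
    case False
    have "((\<lambda>F. x (?S F)) \<longlongrightarrow> 0) (finite_subsets_at_top UNIV)"
    proof (rule order_tendstoI)
      fix e :: real assume e: "0 < e"
      define G where "G = {m. \<not> x (Poly_Mapping.single m (c m)) < e}"
      have "x (?S F) < e" if F: "finite F" "G \<subseteq> F" for F
      proof -
        have "x (?S (F - G)) < e"
          by (rule Tan_sum_less[OF e]) (auto simp: G_def)
        moreover have "x (?S G) < e"
          using False e by (auto simp: G_def)
        ultimately show ?thesis
          unfolding split[OF F] using Tan_add[of "?S G" "?S (F - G)"] by simp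
      qed
      then show "\<forall>\<^sub>F F in finite_subsets_at_top UNIV. x (?S F) < e"
        using fin[OF e, folded G_def] unfolding eventually_finite_subsets_at_top by blast
    qed (auto intro: always_eventually less_le_trans[OF _ Tan_nonneg])
    then show ?thesis ..
  qed
  then obtain L where L: "((\<lambda>F. x (?S F)) \<longlongrightarrow> L) (finite_subsets_at_top UNIV)" ..
  then show ?thesis
    unfolding abs_at_def tendsto_Lim[OF finite_subsets_at_top_neq_bot L] .
qed

lemma abs_at_bounds:
  assumes conv: "((\<lambda>m. x (Poly_Mapping.single m (c m))) \<longlongrightarrow> 0) cofinite"
    and R: "R \<ge> 0" "\<And>m. x (Poly_Mapping.single m (c m)) \<le> R"
  shows "0 \<le> abs_at c x" "abs_at c x \<le> R"
proof -
  show "0 \<le> abs_at c x"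
    by (rule tendsto_lowerbound[OF abs_at_tendsto[OF conv]]) (simp_all add: Tan_nonneg)
  show "abs_at c x \<le> R"
    by (rule tendsto_upperbound[OF abs_at_tendsto[OF conv]]) (simp_all add: Tan_sum_le R)
qed

text \<open>Every finite partial sum containing \<open>m0\<close> already has the dominant value, so
  the limit is that of an eventually constant net.\<close>

lemma abs_at_dominant:
  assumes m0: "\<And>m. m \<noteq> m0 \<Longrightarrow> x (Poly_Mapping.single m (c m)) < x (Poly_Mapping.single m0 (c m0))"
    and pos: "x (Poly_Mapping.single m0 (c m0)) > 0"
  shows "abs_at c x = x (Poly_Mapping.single m0 (c m0))"
proof -
  let ?S = "\<lambda>F. \<Sum>m\<in>F. Poly_Mapping.single m (c m)"
  have "x (?S F) = x (Poly_Mapping.single m0 (c m0))" if F: "finite F" "m0 \<in> F" for F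
  proof -
    have "x (?S (F - {m0})) < x (Poly_Mapping.single m0 (c m0))"
      by (rule Tan_sum_less[OF pos]) (auto intro: m0)
    then show ?thesis
      unfolding sum.remove[OF F] by (rule Tan_add_eq)
  qed
  then have "\<forall>\<^sub>F F in finite_subsets_at_top UNIV. x (?S F) = x (Poly_Mapping.single m0 (c m0))"
    unfolding eventually_finite_subsets_at_top by (intro exI[of _ "{m0}"]) simp
  then show ?thesis
    unfolding abs_at_def by (intro tendsto_Lim tendsto_eventually) simp_all
qed

end

lemma continuous_on_Tan_trop: "continuous_on Tan (trop :: ('g::finite) point \<Rightarrow> _)"
proof -
  have "continuous_on Tan (\<lambda>x :: 'g point. x f)" for f
    by (rule continuous_on_subset[OF continuous_on_product_coordinates]) simp
  moreover have "x (Poly_Mapping.single m 1) \<noteq> 0" if "x \<in> Tan" for x :: "'g point" and m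
    using Tan_character_pos[OF that, of m] by simp
  ultimately show ?thesis
    unfolding trop_def[abs_def]
    by (intro continuous_on_vec_lambda continuous_on_minus continuous_on_ln) auto
qed

text \<open>The unit element of the torus is a K-point.\<close>

lemma Tan_nonempty: "(Tan :: ('g::finite) point set) \<noteq> {}"
proof -
  let ?e = "keys_sum (\<lambda>(m :: int ^ 'g) (c :: complex fls). c)"
  have "(\<lambda>f. absK (?e f)) \<in> Tan"
    unfolding Tan_def
    by (auto simp: absK_nonneg keys_sum_add keys_sum_mult keys_sum_single absK_add absK_mult)
  then show ?thesis
    by blast
qed

section \<open>Translation by periods\<close>

context
  fixes b :: "'l \<Rightarrow> int ^ 'g::finite \<Rightarrow> complex fls"
  assumes b_nonzero: "\<And>l m. b l m \<noteq> 0"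
    and b_add: "\<And>l m m'. b l (m + m') = b l m * b l m'"
begin

lemma translate_eq: "translate b l x f = x (keys_sum (\<lambda>m c. Poly_Mapping.single m (b l m * c)) f)"
  by (simp add: translate_def keys_sum_def)

lemma translate_single:
  "translate b l x (Poly_Mapping.single m c) = x (Poly_Mapping.single m (b l m * c))"
  by (simp add: translate_eq keys_sum_single)

text \<open>Translation is composition with the ring endomorphism
  \<open>z^m \<mapsto> b l m z^m\<close>, which fixes constants because
  \<open>b l 0 = 1\<close>.\<close>

lemma translate_in_Tan:
  assumes x: "x \<in> Tan"
  shows "translate b l x \<in> Tan"
proof -
  have b0: "b l 0 = 1"
    using b_add[of l 0 0] b_nonzero[of l 0] by simp
  let ?T = "keys_sum (\<lambda>m c. Poly_Mapping.single m (b l m * c))"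
  have add: "?T (f + h) = ?T f + ?T h" for f h
    by (rule keys_sum_add) (simp_all add: distrib_right distrib_left single_add)
  have mult: "?T (f * h) = ?T f * ?T h" for f h
    by (rule keys_sum_mult) (simp_all add: distrib_right distrib_left single_add mult_single b_add ac_simps)
  have const: "?T (Poly_Mapping.single 0 c) = Poly_Mapping.single 0 c" for c
    by (simp add: keys_sum_single b0)
  show ?thesis
    unfolding Tan_def translate_eq
    by (simp add: add mult const Tan_nonneg[OF x] Tan_add[OF x] Tan_mult[OF x] Tan_const[OF x])
qed

lemma trop_translate:
  assumes x: "x \<in> Tan"
  shows "trop (translate b l x) = trop x + (\<chi> i. - ln (absK (b l (axis i 1))))"
proof -
  have "- ln (absK (b l (axis i 1)) * exp (- (trop x $ i))) = trop x $ i - ln (absK (b l (axis i 1)))"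
    for i
    using absK_pos[OF b_nonzero, of l "axis i 1"] by (simp add: ln_mult)
  then show ?thesis
    by (simp add: vec_eq_iff trop_def[of "translate b l x"] translate_single Tan_single[OF x]
        rvec_axis inner_axis')
qed

end

section \<open>Cokernels\<close>

text \<open>Reducing coordinates modulo \<open>D\<close> changes a vector by an element of the
  image, so the finitely many residue vectors represent all classes.\<close>

lemma finite_coker_if_multiples:
  fixes h :: "'l::ab_group_add \<Rightarrow> int ^ 'g::finite"
  assumes add: "\<And>l l'. h (l + l') = h l + h l'"
    and D: "D > 0" "\<And>m. int D *s m \<in> range h"
  shows "finite (coker h)"
proof -
  have diff: "h (l - l') = h l - h l'" for l l'
    using add[of "l - l'" l'] by simp
  define R where "R = {r :: int ^ 'g. \<forall>i. 0 \<le> r $ i \<and> r $ i < int D}"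
  have "norm (rvec r) \<le> real CARD('g) * real D" if "r \<in> R" for r
  proof -
    have "norm (rvec r) \<le> (\<Sum>i\<in>UNIV. \<bar>rvec r $ i\<bar>)"
      by (rule norm_le_l1_cart)
    also have "\<dots> \<le> (\<Sum>i\<in>(UNIV :: 'g set). real D)"
    proof (rule sum_mono)
      fix i
      have "0 \<le> r $ i" "r $ i < int D"
        using that by (auto simp: R_def)
      then have "\<bar>real_of_int (r $ i)\<bar> \<le> real_of_int (int D)"
        by simp
      then show "\<bar>rvec r $ i\<bar> \<le> real D"
        by (simp add: rvec_def)
    qed
    finally show ?thesis
      by simp
  qed
  then have "finite R"
    by (intro finite_subset[OF _ finite_rvec_ball[of "real CARD('g) * real D"]]) auto
  moreover have "coker h \<subseteq> (\<lambda>r. {m'. m' - r \<in> range h}) ` R"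
  proof
    fix \<mu> assume "\<mu> \<in> coker h"
    then obtain m where m: "\<mu> = {m'. m' - m \<in> range h}"
      by (auto simp: coker_def quotient_def)
    define r :: "int ^ 'g" where "r = (\<chi> i. m $ i mod int D)"
    have "m - r = int D *s (\<chi> i. m $ i div int D)"
      by (simp add: vec_eq_iff r_def minus_mod_eq_mult_div)
    with D(2) obtain l where l: "m - r = h l"
      by (metis imageE)
    have "m' - m \<in> range h \<longleftrightarrow> m' - r \<in> range h" for m'
    proof
      assume "m' - m \<in> range h"
      then obtain l' where "m' - m = h l'" by blast
      moreover have "m' - r = (m' - m) + (m - r)"
        by simp
      ultimately have "m' - r = h (l' + l)"
        by (simp only: add l)
      then show "m' - r \<in> range h" by blast
    next
      assume "m' - r \<in> range h"
      then obtain l' where "m' - r = h l'" by blast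
      moreover have "m' - m = (m' - r) - (m - r)"
        by simp
      ultimately have "m' - m = h (l' - l)"
        by (simp only: diff l)
      then show "m' - m \<in> range h" by blast
    qed
    moreover have "r \<in> R"
      using D(1) by (simp add: R_def r_def)
    ultimately show "\<mu> \<in> (\<lambda>r. {m'. m' - r \<in> range h}) ` R"
      unfolding m by auto
  qed
  ultimately show ?thesis
    by (meson finite_imageI finite_subset)
qed

text \<open>Among the multiples 0 to \<open>n\<close> of \<open>m\<close> two share a class, so some
  \<open>j - i \<le> n\<close> times \<open>m\<close> lies in the image. The factorial is a multiple
  of every such difference, which makes \<open>D\<close> independent of \<open>m\<close>.\<close>

lemma multiples_if_finite_coker:
  fixes h :: "'l::ab_group_add \<Rightarrow> int ^ 'g::finite"
  assumes add: "\<And>l l'. h (l + l') = h l + h l'" and fin: "finite (coker h)"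
  obtains D where "D > 0" "\<And>m. int D *s m \<in> range h"
proof
  define n where "n = card (coker h)"
  have scale: "int j *s h l \<in> range h" for j l
  proof (induction j)
    case 0
    have "h 0 = 0" using add[of 0 0] by simp
    then show ?case by (metis of_nat_0 rangeI vector_smult_lzero)
  next
    case (Suc j)
    then obtain l' where "int j *s h l = h l'" by blast
    then have "int (Suc j) *s h l = h (l + l')"
      by (simp add: vector_sadd_rdistrib add)
    then show ?case by (metis rangeI)
  qed
  show "(fact n :: nat) > 0"
    by simp
  fix m
  define c where "c j = {m'. m' - int j *s m \<in> range h}" for j
  have "c ` {0..n} \<subseteq> coker h"
    by (auto simp: c_def coker_def quotient_def)
  then have "card (c ` {0..n}) \<le> n"
    unfolding n_def by (rule card_mono[OF fin])
  then have not_inj: "\<not> inj_on c {0..n}"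
    by (intro pigeonhole) simp
  have "\<exists>i j. c i = c j \<and> i < j \<and> j \<le> n"
  proof (rule ccontr)
    assume "\<not> ?thesis"
    then have "inj_on c {0..n}"
      by (intro linorder_inj_onI) auto
    with not_inj show False ..
  qed
  then obtain i j where ij: "c i = c j" "i < j" "j \<le> n"
    by blast
  have "0 = h 0"
    using add[of 0 0] by simp
  then have "int j *s m \<in> c j"
    by (simp add: c_def)
  then have "int j *s m - int i *s m \<in> range h"
    unfolding ij(1)[symmetric] by (simp add: c_def)
  moreover have "int j *s m - int i *s m = int (j - i) *s m"
    using ij(2) by (simp add: of_nat_diff vec_eq_iff algebra_simps)
  ultimately obtain l where l: "int (j - i) *s m = h l"
    by auto
  have "(j - i) dvd (fact n :: nat)"
    using ij by (intro dvd_fact) auto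
  then obtain q where "fact n = (j - i) * q"
    by blast
  then have "int (fact n) *s m = int q *s (int (j - i) *s m)"
    by (simp add: vector_smult_assoc mult.commute)
  then show "int (fact n) *s m \<in> range h"
    unfolding l using scale by metis
qed


section \<open>The form of a polarization and the theta functions\<close>

locale theta_data = polarized_tdav \<Phi> a b
  for \<Phi> :: "'l::ab_group_add \<Rightarrow> int ^ 'g::finite" and a b +
  fixes v :: "complex fls alg_closure \<Rightarrow> real"
    and ak :: "nat \<Rightarrow> int ^ 'g \<Rightarrow> complex fls alg_closure"
    and bk :: "nat \<Rightarrow> int ^ 'g \<Rightarrow> int ^ 'g \<Rightarrow> complex fls alg_closure"
  assumes v: "extends_absK v"
    and ext: "k \<ge> 1 \<Longrightarrow> theta_extension \<Phi> a b k (ak k) (bk k)"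
begin

lemma v_mult: "v (x * y) = v x * v y"
  and v_to_ac: "v (to_ac c) = absK c"
  and v_eq_0_iff: "v x = 0 \<longleftrightarrow> x = 0"
  and v_pos: "x \<noteq> 0 \<Longrightarrow> v x > 0"
  using v by (auto simp: extends_absK_def less_le)

context
  fixes k :: nat
  assumes k: "k \<ge> 1"
begin

lemma ak_nonzero: "ak k m \<noteq> 0"
  and bk_nonzero: "bk k m m' \<noteq> 0"
  and bk_add_left: "bk k (m + m') n = bk k m n * bk k m' n"
  and bk_add_right: "bk k m (n + n') = bk k m n * bk k m n'"
  and bk_sym: "bk k m m' = bk k m' m"
  and ak_Phi: "ak k (mult_hom k \<Phi> l) = to_ac (a l ^ k)"
  and bk_Phi: "bk k (mult_hom k \<Phi> l) m = to_ac (b l m)"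
  and ak_add: "ak k (m + m') = ak k m * ak k m' * bk k m m'"
  and ak_square: "ak k m ^ 2 = bk k m m"
  using ext[OF k] unfolding theta_extension_def by blast+

lemma ln_bk_add_left: "- ln (v (bk k (m + m') n)) = - ln (v (bk k m n)) + - ln (v (bk k m' n))"
  by (simp add: bk_add_left v_mult ln_mult v_eq_0_iff bk_nonzero)

lemma ln_bk_add_right: "- ln (v (bk k m (n + n'))) = - ln (v (bk k m n)) + - ln (v (bk k m n'))"
  by (simp add: bk_add_right v_mult ln_mult v_eq_0_iff bk_nonzero)

end

text \<open>Since \<open>b\<close> is given only on \<open>\<Lambda>\<close> times M, the Gram
  matrix is read off from the level 1 extension \<open>bk 1\<close>. That the choice of extension
  does not matter follows from \<open>B_form_eq\<close>.\<close>

definition form :: "real ^ 'g \<Rightarrow> real ^ 'g \<Rightarrow> real" where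
  "form x y = (\<Sum>i\<in>UNIV. x $ i * (\<Sum>j\<in>UNIV. y $ j * - ln (v (bk 1 (axis i 1) (axis j 1)))))"

lemma form_rvec: "form (rvec m) (rvec m') = - ln (v (bk 1 m m'))"
proof -
  have "- ln (v (bk 1 m m')) = (\<Sum>i\<in>UNIV. real_of_int (m $ i) * - ln (v (bk 1 (axis i 1) m')))"
    by (rule int_vec_expansion[of "\<lambda>m. - ln (v (bk 1 m m'))"]) (simp only: ln_bk_add_left[OF order_refl])
  also have "\<dots> = form (rvec m) (rvec m')"
  proof -
    have "- ln (v (bk 1 n m')) = (\<Sum>j\<in>UNIV. real_of_int (m' $ j) * - ln (v (bk 1 n (axis j 1))))" for n
      by (rule int_vec_expansion[of "\<lambda>m'. - ln (v (bk 1 n m'))"])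
        (simp only: ln_bk_add_right[OF order_refl])
    then show ?thesis
      unfolding form_def rvec_def vec_lambda_beta by simp
  qed
  finally show ?thesis by simp
qed

lemma form_bilinear: "bilinear form"
proof -
  have "form (x + y) z = form x z + form y z" "form x (y + z) = form x y + form x z"
    "form (c *\<^sub>R x) y = c *\<^sub>R form x y" "form x (c *\<^sub>R y) = c *\<^sub>R form x y" for c x y z
    by (simp_all only: form_def vector_add_component vector_scaleR_component distrib_right
        distrib_left sum.distrib sum_distrib_left real_scaleR_def ac_simps)
  then show ?thesis
    by (auto simp: bilinear_def intro!: linearI)
qed

lemma form_sym: "form x y = form y x"
proof -
  have "form x y = (\<Sum>i\<in>UNIV. \<Sum>j\<in>UNIV. x $ i * (y $ j * - ln (v (bk 1 (axis i 1) (axis j 1)))))"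
    by (simp only: form_def sum_distrib_left)
  also have "\<dots> = (\<Sum>j\<in>UNIV. \<Sum>i\<in>UNIV. x $ i * (y $ j * - ln (v (bk 1 (axis i 1) (axis j 1)))))"
    by (rule sum.swap)
  also have "\<dots> = form y x"
    unfolding form_def sum_distrib_left
  proof (intro sum.cong refl)
    fix i j
    show "x $ i * (y $ j * - ln (v (bk 1 (axis i 1) (axis j 1))))
        = y $ j * (x $ i * - ln (v (bk 1 (axis j 1) (axis i 1))))"
      by (subst bk_sym[OF order_refl]) (rule mult.left_commute)
  qed
  finally show ?thesis .
qed

lemma mult_hom_1: "mult_hom 1 \<Phi> = \<Phi>"
  by (simp add: mult_hom_def fun_eq_iff)

lemma mult_hom_add: "mult_hom k \<Phi> (l + l') = mult_hom k \<Phi> l + mult_hom k \<Phi> l'"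
  by (simp add: mult_hom_def Phi_add vector_add_ldistrib)

lemma mult_hom_diff: "mult_hom k \<Phi> (l - l') = mult_hom k \<Phi> l - mult_hom k \<Phi> l'"
  using mult_hom_add[of k "l - l'" l'] by simp

lemma mult_hom_inj: "k \<ge> 1 \<Longrightarrow> inj (mult_hom k \<Phi>)"
  using Phi_inj by (auto simp: inj_def mult_hom_def vec_eq_iff)

lemma Phi_eq_0_iff: "\<Phi> l = 0 \<longleftrightarrow> l = 0"
proof -
  have "\<Phi> 0 = 0" using Phi_add[of 0 0] by simp
  then show ?thesis using Phi_inj by (metis injD)
qed

lemma form_Phi: "form (rvec (\<Phi> l)) (rvec m) = - ln (absK (b l m))"
  using bk_Phi[OF order_refl, of l m] unfolding mult_hom_1 by (simp only: form_rvec v_to_ac)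

text \<open>The normalization \<open>a^2 = q\<close> leaves no linear term in \<open>- ln\<close> of
  \<open>a\<close>, so that it matches the constant in the shift formulas.\<close>

lemma form_Phi_Phi: "form (rvec (\<Phi> l)) (rvec (\<Phi> l)) / 2 = - ln (absK (a l))"
proof -
  have "absK (b l (\<Phi> l)) = absK (a l) * absK (a l)"
    by (simp flip: a_square absK_mult add: power2_eq_square)
  then show ?thesis
    using absK_pos[OF a_nonzero, of l] by (simp add: form_Phi ln_mult)
qed

lemma Phi_multiples:
  obtains D where "D > 0" "\<And>m. \<exists>l. int D *s m = \<Phi> l"
  using multiples_if_finite_coker[of \<Phi>] Phi_add Phi_coker by (metis imageE)

text \<open>On \<open>\<Lambda>\<close> the form takes integer values, so positive means at least 1.
  Since \<open>D m\<close> lies in the image of \<open>\<Phi>\<close>, the form is at least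
  \<open>1 / D^2\<close> on all nonzero vectors of M.\<close>

lemma form_pos:
  assumes "y \<noteq> 0"
  shows "form y y > 0"
proof -
  obtain D where D: "D > 0" "\<And>m. \<exists>l. int D *s m = \<Phi> l"
    using Phi_multiples by blast
  have "1 / real D ^ 2 \<le> form (rvec m) (rvec m)" if m: "m \<noteq> 0" for m
  proof -
    obtain l where l: "int D *s m = \<Phi> l"
      using D(2) by blast
    have "l \<noteq> 0"
      using m D(1) l Phi_eq_0_iff[of l] by (auto simp: vec_eq_iff)
    from q_pos[OF this] have "of_int (fls_subdegree (b l (\<Phi> l))) > (0 :: real)"
      by (simp only: ln_absK[OF b_nonzero])
    then have "fls_subdegree (b l (\<Phi> l)) \<ge> 1"
      by simp
    then have "1 \<le> form (rvec (\<Phi> l)) (rvec (\<Phi> l))"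
      unfolding form_Phi ln_absK[OF b_nonzero] by simp
    also have "\<dots> = real D ^ 2 * form (rvec m) (rvec m)"
      unfolding l[symmetric] rvec_scale bilinear_lmul[OF form_bilinear]
        bilinear_rmul[OF form_bilinear] by (simp add: power2_eq_square)
    finally show ?thesis
      using D(1) by (simp add: field_simps)
  qed
  then show ?thesis
    using assms D(1)
    by (intro bilinear_pos_if_pos_on_lattice[OF form_bilinear form_sym, of "1 / real D ^ 2"]) auto
qed

sublocale pos_def_form form
  by unfold_locales (simp_all add: form_bilinear form_sym form_pos)

text \<open>For uniqueness, two candidates agree on the image of \<open>\<Phi>\<close> times M;
  dividing by \<open>D\<close> makes them agree on the standard basis.\<close>

lemma B_form_eq: "B_form \<Phi> b = form"
  unfolding B_form_def
proof (rule the_equality)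
  show "bilinear form \<and> (\<forall>l m. form (rvec (\<Phi> l)) (rvec m) = - ln (absK (b l m)))"
    by (simp add: form_bilinear form_Phi)
next
  fix B assume B: "bilinear B \<and> (\<forall>l m. B (rvec (\<Phi> l)) (rvec m) = - ln (absK (b l m)))"
  obtain D where D: "D > 0" "\<And>m. \<exists>l. int D *s m = \<Phi> l"
    using Phi_multiples by blast
  have eq: "B (rvec m) (rvec m') = form (rvec m) (rvec m')" for m m'
  proof -
    obtain l where l: "int D *s m = \<Phi> l"
      using D(2) by blast
    have "B (rvec (\<Phi> l)) (rvec m') = form (rvec (\<Phi> l)) (rvec m')"
      using B by (simp add: form_Phi)
    then show ?thesis
      using D(1) B by (simp flip: l add: rvec_scale bilinear_lmul B_simps)
  qed
  show "B = form"
  proof (rule bilinear_eq_stdbasis)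
    fix i j :: "real ^ 'g" assume "i \<in> Basis" "j \<in> Basis"
    then obtain i' j' where "i = axis i' 1" "j = axis j' 1"
      by (auto simp: Basis_vec_def)
    then have "i = rvec (axis i' 1)" "j = rvec (axis j' 1)"
      by (simp_all add: rvec_axis)
    then show "B i j = form i j"
      by (simp only: eq)
  qed (use B form_bilinear in auto)
qed

lemma nacy_metric_eq: "nacy_metric \<Phi> b x = legendre (trop x)"
  by (simp add: nacy_metric_def A_dual_def A_form_def B_form_eq legendre_def)

lemma finite_coker_mult_hom:
  assumes k: "k \<ge> 1"
  shows "finite (coker (mult_hom k \<Phi>))"
proof -
  obtain D where D: "D > 0" "\<And>m. \<exists>l. int D *s m = \<Phi> l"
    using Phi_multiples by blast
  show ?thesis
  proof (rule finite_coker_if_multiples[OF mult_hom_add])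
    show "k * D > 0"
      using k D(1) by simp
    fix m
    obtain l where "int D *s m = \<Phi> l"
      using D(2) by blast
    then have "int (k * D) *s m = mult_hom k \<Phi> l"
      by (simp add: mult_hom_def vector_smult_assoc flip: \<open>int D *s m = \<Phi> l\<close>)
    then show "int (k * D) *s m \<in> range (mult_hom k \<Phi>)"
      by blast
  qed
qed

text \<open>The defining relation fixes \<open>bk k\<close> at \<open>k D m = k \<Phi>(l)\<close>.
  Additivity of \<open>- ln\<close> allows division by \<open>k D\<close>, whatever roots were
  chosen in the closure.\<close>

lemma ln_v_bk:
  assumes k: "k \<ge> 1"
  shows "- ln (v (bk k m m')) = form (rvec m) (rvec m') / real k"
proof -
  obtain D where D: "D > 0" "\<And>m. \<exists>l. int D *s m = \<Phi> l"
    using Phi_multiples by blast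
  obtain l where l: "int D *s m = \<Phi> l"
    using D(2) by blast
  have "v (bk k 0 m') = 1"
    using bk_add_left[OF k, of 0 0 m'] v_mult[of "bk k 0 m'" "bk k 0 m'"]
      bk_nonzero[OF k, of 0 m'] v_to_ac[of 1] by auto
  then have scale: "- ln (v (bk k (int j *s m) m')) = real j * - ln (v (bk k m m'))" for j
  proof (induction j)
    case (Suc j)
    have "int (Suc j) *s m = m + int j *s m"
      by (simp add: vector_sadd_rdistrib)
    then show ?case
      using Suc by (simp only: ln_bk_add_left[OF k]) (simp add: distrib_right)
  qed simp
  have "mult_hom k \<Phi> l = int (k * D) *s m"
    by (simp add: mult_hom_def vector_smult_assoc flip: l)
  then have "real (k * D) * - ln (v (bk k m m')) = - ln (absK (b l m'))"
    using bk_Phi[OF k, of l m'] scale[of "k * D"] by (simp only: v_to_ac)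
  also have "\<dots> = real D * form (rvec m) (rvec m')"
    by (simp add: rvec_scale B_simps flip: form_Phi l)
  finally have "real D * (real k * - ln (v (bk k m m'))) = real D * form (rvec m) (rvec m')"
    by (simp only: of_nat_mult ac_simps)
  then have "real k * - ln (v (bk k m m')) = form (rvec m) (rvec m')"
    using D(1) by (subst (asm) mult_cancel_left) simp
  then show ?thesis
    using k by (simp add: eq_divide_eq mult.commute)
qed

section \<open>Absolute values of the theta functions\<close>

lemma v_ak_mult_character:
  assumes k: "k \<ge> 1"
  shows "v (ak k m) * exp (- (rvec m \<bullet> n)) = exp (lattice_term k n m)"
proof -
  have pos: "v (ak k m) > 0"
    by (rule v_pos[OF ak_nonzero[OF k]])
  have "v (bk k m m) = v (ak k m) * v (ak k m)"
    by (simp flip: ak_square[OF k] v_mult add: power2_eq_square)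
  then have "2 * - ln (v (ak k m)) = form (rvec m) (rvec m) / real k"
    using pos by (simp add: ln_mult flip: ln_v_bk[OF k])
  then have "ln (v (ak k m)) = - (form (rvec m) (rvec m) / (2 * real k))"
    by simp
  then have "v (ak k m) = exp (- (form (rvec m) (rvec m) / (2 * real k)))"
    using pos by (metis exp_ln)
  then show ?thesis
    by (simp add: lattice_term_def mult_exp_exp)
qed

text \<open>Over the closure, \<open>ak k m\<close> times the theta function of \<open>m\<close> is
  the sum of \<open>ak k m' z^m'\<close> over the class of \<open>m\<close>, an expression
  independent of the lift. This is what the weights in the balanced metric achieve.\<close>

lemma to_ac_theta:
  assumes k: "k \<ge> 1" and m': "m' - m \<in> range (mult_hom k \<Phi>)"
  shows "to_ac (theta \<Phi> a b k m m') = ak k m' / ak k m"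
proof -
  obtain l where l: "m' = m + mult_hom k \<Phi> l"
    using m' by (auto simp: diff_eq_eq add.commute)
  have "{l'. m' = m + mult_hom k \<Phi> l'} = {l}"
    using mult_hom_inj[OF k] by (auto simp: l inj_def)
  then have "theta \<Phi> a b k m m' = a l ^ k * b l m"
    by (simp add: theta_def)
  moreover have "ak k m' = ak k m * to_ac (a l ^ k) * to_ac (b l m)"
    by (simp only: l ak_add[OF k] ak_Phi[OF k] bk_sym[OF k, of m] bk_Phi[OF k])
  ultimately show ?thesis
    using ak_nonzero[OF k, of m] by (simp add: field_simps)
qed

lemma theta_outside_class:
  assumes "m' - m \<notin> range (mult_hom k \<Phi>)"
  shows "theta \<Phi> a b k m m' = 0"
proof -
  have "{l. m' = m + mult_hom k \<Phi> l} = {}"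
    using assms by auto
  then show ?thesis
    unfolding theta_def by (simp only: sum.empty)
qed

lemma absK_theta:
  assumes k: "k \<ge> 1"
  shows "v (ak k m) * (absK (theta \<Phi> a b k m m') * exp (- (rvec m' \<bullet> n)))
    = (if m' - m \<in> range (mult_hom k \<Phi>) then exp (lattice_term k n m') else 0)"
proof (cases "m' - m \<in> range (mult_hom k \<Phi>)")
  case True
  have "ak k m * to_ac (theta \<Phi> a b k m m') = ak k m'"
    using to_ac_theta[OF k True] ak_nonzero[OF k, of m] by simp
  then have "v (ak k m) * absK (theta \<Phi> a b k m m') = v (ak k m')"
    by (simp flip: v_to_ac v_mult)
  then show ?thesis
    using True v_ak_mult_character[OF k, of m' n] by (simp flip: mult.assoc)
qed (simp add: theta_outside_class)

lemma theta_tendsto_0: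
  assumes k: "k \<ge> 1"
  shows "((\<lambda>m'. absK (theta \<Phi> a b k m m') * exp (- (rvec m' \<bullet> n))) \<longlongrightarrow> 0) cofinite"
proof (rule tendsto_0_le)
  show "((\<lambda>m'. exp (lattice_term k n m') / v (ak k m)) \<longlongrightarrow> 0) cofinite"
    using exp_lattice_term_tendsto_0[of k n] k by (intro tendsto_divide_zero) simp
  show "\<forall>\<^sub>F m' in cofinite. norm (absK (theta \<Phi> a b k m m') * exp (- (rvec m' \<bullet> n)))
      \<le> norm (exp (lattice_term k n m') / v (ak k m)) * 1"
  proof (intro always_eventually allI)
    fix m'
    have pos: "v (ak k m) > 0"
      by (rule v_pos[OF ak_nonzero[OF k]])
    have "v (ak k m) * (absK (theta \<Phi> a b k m m') * exp (- (rvec m' \<bullet> n)))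
        \<le> exp (lattice_term k n m')"
      by (simp add: absK_theta[OF k])
    then show "norm (absK (theta \<Phi> a b k m m') * exp (- (rvec m' \<bullet> n)))
        \<le> norm (exp (lattice_term k n m') / v (ak k m)) * 1"
      using pos absK_nonneg by (simp add: pos_le_divide_eq mult.commute)
  qed
qed

text \<open>By the ratio formula, invariance becomes the quadratic law of \<open>ak\<close>; the
  comparison takes place in the closure and descends because \<open>to_ac\<close> is
  injective.\<close>

lemma theta_in_sections:
  assumes k: "k \<ge> 1"
  shows "theta \<Phi> a b k m \<in> sections \<Phi> a b k"
proof -
  have "tau \<Phi> a b k l (theta \<Phi> a b k m) m' = theta \<Phi> a b k m m'" for l m'
  proof -
    let ?m = "m' - mult_hom k \<Phi> l"
    have iff: "?m - m \<in> range (mult_hom k \<Phi>) \<longleftrightarrow> m' - m \<in> range (mult_hom k \<Phi>)"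
    proof
      assume "?m - m \<in> range (mult_hom k \<Phi>)"
      then obtain j where "?m - m = mult_hom k \<Phi> j" by blast
      then have "m' - m = mult_hom k \<Phi> (j + l)"
        by (simp add: mult_hom_add algebra_simps)
      then show "m' - m \<in> range (mult_hom k \<Phi>)" by blast
    next
      assume "m' - m \<in> range (mult_hom k \<Phi>)"
      then obtain j where "m' - m = mult_hom k \<Phi> j" by blast
      then have "?m - m = mult_hom k \<Phi> (j - l)"
        by (simp add: mult_hom_diff algebra_simps)
      then show "?m - m \<in> range (mult_hom k \<Phi>)" by blast
    qed
    show ?thesis
    proof (cases "m' - m \<in> range (mult_hom k \<Phi>)")
      case True
      have "ak k m' = ak k (?m + mult_hom k \<Phi> l)"
        by simp
      also have "\<dots> = ak k ?m * to_ac (a l ^ k) * to_ac (b l ?m)"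
        by (simp only: ak_add[OF k] ak_Phi[OF k] bk_sym[OF k, of ?m] bk_Phi[OF k])
      finally have "to_ac (a l ^ k * b l ?m * theta \<Phi> a b k m ?m) = to_ac (theta \<Phi> a b k m m')"
        using True iff by (simp add: to_ac_theta[OF k])
      then show ?thesis
        by (simp only: tau_def to_ac_eq_iff)
    next
      case False
      then show ?thesis
        using iff by (simp add: tau_def theta_outside_class)
    qed
  qed
  then show ?thesis
    using theta_tendsto_0[OF k] by (auto simp: sections_def entire_def)
qed

text \<open>Here \<open>m0\<close> is a maximizer over all of M, so it bounds every class. Two
  characters of one class differ by \<open>k \<Phi>(l)\<close>, so in its own class
  \<open>m0\<close> is the strict maximum and dominates the series.\<close>

lemma
  assumes k: "k \<ge> 2" and x: "x \<in> Tan"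
    and max: "\<And>m. lattice_term k (trop x) m \<le> lattice_term k (trop x) m0"
  shows abs_at_theta_bounds: "0 \<le> abs_at (theta \<Phi> a b k m) x"
      "v (ak k m) * abs_at (theta \<Phi> a b k m) x \<le> exp (lattice_term k (trop x) m0)"
    and abs_at_theta_eq: "m0 - m \<in> range (mult_hom k \<Phi>) \<Longrightarrow>
      v (ak k m) * abs_at (theta \<Phi> a b k m) x = exp (lattice_term k (trop x) m0)"
proof -
  have k1: "k \<ge> 1" using k by simp
  let ?t = "\<lambda>m'. x (Poly_Mapping.single m' (theta \<Phi> a b k m m'))"
  have pos: "v (ak k m) > 0"
    by (rule v_pos[OF ak_nonzero[OF k1]])
  have t: "v (ak k m) * ?t m'
      = (if m' - m \<in> range (mult_hom k \<Phi>) then exp (lattice_term k (trop x) m') else 0)" for m'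
    by (simp add: Tan_single[OF x] absK_theta[OF k1])
  have conv: "(?t \<longlongrightarrow> 0) cofinite"
    unfolding Tan_single[OF x] by (rule theta_tendsto_0[OF k1])
  define R where "R = exp (lattice_term k (trop x) m0) / v (ak k m)"
  have vR: "v (ak k m) * R = exp (lattice_term k (trop x) m0)"
    using pos by (simp add: R_def)
  have "R \<ge> 0"
    using pos by (simp add: R_def)
  moreover have "?t m' \<le> R" for m'
  proof -
    have "v (ak k m) * ?t m' \<le> v (ak k m) * R"
      using max[of m'] by (simp add: t vR)
    then show ?thesis
      using pos by simp
  qed
  ultimately have "0 \<le> abs_at (theta \<Phi> a b k m) x" "abs_at (theta \<Phi> a b k m) x \<le> R"
    by (rule abs_at_bounds[OF x conv])+
  then show "0 \<le> abs_at (theta \<Phi> a b k m) x"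
    and "v (ak k m) * abs_at (theta \<Phi> a b k m) x \<le> exp (lattice_term k (trop x) m0)"
    using pos by (simp_all flip: vR)
  show "v (ak k m) * abs_at (theta \<Phi> a b k m) x = exp (lattice_term k (trop x) m0)"
    if m0: "m0 - m \<in> range (mult_hom k \<Phi>)"
  proof -
    have t0: "v (ak k m) * ?t m0 = exp (lattice_term k (trop x) m0)"
      by (simp add: t m0)
    have "?t m' < ?t m0" if ne: "m' \<noteq> m0" for m'
    proof -
      have "lattice_term k (trop x) m' < lattice_term k (trop x) m0"
        if m': "m' - m \<in> range (mult_hom k \<Phi>)"
      proof -
        obtain l l0 where "m' - m = mult_hom k \<Phi> l" "m0 - m = mult_hom k \<Phi> l0"
          using m' m0 by blast
        then have m'_eq: "m' = m0 + int k *s \<Phi> (l - l0)"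
          using mult_hom_diff[of k l l0] by (simp add: mult_hom_def algebra_simps)
        with ne have "\<Phi> (l - l0) \<noteq> 0"
          by auto
        then show ?thesis
          unfolding m'_eq by (rule lattice_term_max_unique_mod[OF k max])
      qed
      then have "v (ak k m) * ?t m' < v (ak k m) * ?t m0"
        unfolding t0 by (simp add: t)
      then show ?thesis
        using pos by simp
    qed
    moreover have "?t m0 > 0"
      using pos t0 by (metis exp_gt_zero zero_less_mult_pos)
    ultimately show ?thesis
      using abs_at_dominant[OF x, of m0 "theta \<Phi> a b k m"] t0 by simp
  qed
qed

context
  fixes k :: nat and lift :: "(int ^ 'g) set \<Rightarrow> int ^ 'g"
  assumes k: "k \<ge> 2"
    and lift: "\<And>\<mu>. \<mu> \<in> coker (mult_hom k \<Phi>) \<Longrightarrow> lift \<mu> \<in> \<mu>"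
begin

lemma class_of_character:
  obtains \<mu> where "\<mu> \<in> coker (mult_hom k \<Phi>)" "m0 - lift \<mu> \<in> range (mult_hom k \<Phi>)"
proof
  let ?\<mu> = "{m'. m' - m0 \<in> range (mult_hom k \<Phi>)}"
  show \<mu>: "?\<mu> \<in> coker (mult_hom k \<Phi>)"
    by (auto simp: coker_def quotient_def)
  obtain l where "lift ?\<mu> - m0 = mult_hom k \<Phi> l"
    using lift[OF \<mu>] by blast
  then have "m0 - lift ?\<mu> = mult_hom k \<Phi> (0 - l)"
    using mult_hom_diff[of k 0 0] mult_hom_diff[of k 0 l] by (simp add: algebra_simps)
  then show "m0 - lift ?\<mu> \<in> range (mult_hom k \<Phi>)"
    by blast
qed

lemma theta_no_common_zeros:
  "no_common_zeros (coker (mult_hom k \<Phi>)) (\<lambda>\<mu>. theta \<Phi> a b k (lift \<mu>))"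
  unfolding no_common_zeros_def
proof
  fix x :: "'g point" assume x: "x \<in> Tan"
  obtain m0 where max: "\<And>m. lattice_term k (trop x) m \<le> lattice_term k (trop x) m0"
    using lattice_term_max[of k "trop x"] k by auto
  obtain \<mu> where \<mu>: "\<mu> \<in> coker (mult_hom k \<Phi>)" "m0 - lift \<mu> \<in> range (mult_hom k \<Phi>)"
    by (rule class_of_character)
  have "v (ak k (lift \<mu>)) * abs_at (theta \<Phi> a b k (lift \<mu>)) x \<noteq> 0"
    using abs_at_theta_eq[OF k x max \<mu>(2)] by simp
  then show "\<exists>\<mu>\<in>coker (mult_hom k \<Phi>). abs_at (theta \<Phi> a b k (lift \<mu>)) x \<noteq> 0"
    using \<mu>(1) by auto
qed

lemma balanced_metric_eq:
  assumes x: "x \<in> Tan"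
  shows "balanced_metric \<Phi> a b v k (ak k) lift x = lattice_legendre k (trop x)"
proof -
  obtain m0 where max: "\<And>m. lattice_term k (trop x) m \<le> lattice_term k (trop x) m0"
    using lattice_term_max[of k "trop x"] k by auto
  obtain \<mu>0 where \<mu>0: "\<mu>0 \<in> coker (mult_hom k \<Phi>)" "m0 - lift \<mu>0 \<in> range (mult_hom k \<Phi>)"
    by (rule class_of_character)
  let ?f = "\<lambda>\<mu>. abs_at (theta \<Phi> a b k (lift \<mu>)) x"
  let ?r = "\<lambda>\<mu>. ln (v (ak k (lift \<mu>)))"
  have pos: "v (ak k m) > 0" for m
    using k by (intro v_pos ak_nonzero) simp
  have log: "ln (?f \<mu>) + ?r \<mu> = ln (v (ak k (lift \<mu>)) * ?f \<mu>)" if "?f \<mu> \<noteq> 0" for \<mu>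
  proof -
    have "?f \<mu> > 0"
      using abs_at_theta_bounds(1)[OF k x max, of "lift \<mu>"] that by simp
    then show ?thesis
      using pos[of "lift \<mu>"] by (simp add: ln_mult)
  qed
  have "Max {ln (?f \<mu>) + ?r \<mu> | \<mu>. \<mu> \<in> coker (mult_hom k \<Phi>) \<and> ?f \<mu> \<noteq> 0}
      = lattice_term k (trop x) m0"
  proof (rule Max_eqI)
    have "finite (coker (mult_hom k \<Phi>))"
      using k by (intro finite_coker_mult_hom) simp
    then show "finite {ln (?f \<mu>) + ?r \<mu> | \<mu>. \<mu> \<in> coker (mult_hom k \<Phi>) \<and> ?f \<mu> \<noteq> 0}"
      by simp
  next
    fix y assume "y \<in> {ln (?f \<mu>) + ?r \<mu> | \<mu>. \<mu> \<in> coker (mult_hom k \<Phi>) \<and> ?f \<mu> \<noteq> 0}"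
    then obtain \<mu> where nz: "?f \<mu> \<noteq> 0" and y: "y = ln (v (ak k (lift \<mu>)) * ?f \<mu>)"
      using log by auto
    have "v (ak k (lift \<mu>)) * ?f \<mu> > 0"
      using nz pos[of "lift \<mu>"] abs_at_theta_bounds(1)[OF k x max, of "lift \<mu>"] by simp
    then have "y \<le> ln (exp (lattice_term k (trop x) m0))"
      unfolding y using abs_at_theta_bounds(2)[OF k x max, of "lift \<mu>"]
      by (subst ln_le_cancel_iff) simp_all
    then show "y \<le> lattice_term k (trop x) m0"
      by simp
  next
    have eq: "v (ak k (lift \<mu>0)) * ?f \<mu>0 = exp (lattice_term k (trop x) m0)"
      by (rule abs_at_theta_eq[OF k x max \<mu>0(2)])
    then have nz: "?f \<mu>0 \<noteq> 0"
      by auto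
    then have "lattice_term k (trop x) m0 = ln (?f \<mu>0) + ?r \<mu>0"
      by (simp add: log eq)
    then show "lattice_term k (trop x) m0
        \<in> {ln (?f \<mu>) + ?r \<mu> | \<mu>. \<mu> \<in> coker (mult_hom k \<Phi>) \<and> ?f \<mu> \<noteq> 0}"
      using \<mu>0(1) nz by blast
  qed
  then show ?thesis
    by (simp add: balanced_metric_def nafs_metric_def lattice_legendre_eq[OF max])
qed

end

section \<open>Descent to X and the uniform distance\<close>

lemma trop_translate_Phi:
  assumes x: "x \<in> Tan"
  obtains t where "trop (translate b l x) = trop x + t" "\<And>y. form (rvec (\<Phi> l)) y = t \<bullet> y"
proof
  let ?t = "(\<chi> i. - ln (absK (b l (axis i 1)))) :: real ^ 'g"
  show "trop (translate b l x) = trop x + ?t"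
    by (rule trop_translate[OF b_nonzero b_add_right x])
  have "form (rvec (\<Phi> l)) (axis i 1) = - ln (absK (b l (axis i 1)))" for i
    using form_Phi[of l "axis i 1"] by (simp add: rvec_axis)
  then show "form (rvec (\<Phi> l)) y = ?t \<bullet> y" for y
    by (subst form_eq_inner) simp
qed

text \<open>Serves both metrics. The shift rule is required at lattice vectors only, which is all
  that the discrete transform satisfies and all that periods need.\<close>

lemma metric_if_legendre:
  fixes \<phi> :: "'g point \<Rightarrow> real"
  assumes \<phi>: "\<And>x. x \<in> Tan \<Longrightarrow> \<phi> x = G (trop x)"
    and cont: "continuous_on UNIV G"
    and shift: "\<And>w t n. (\<And>y. form (rvec w) y = t \<bullet> y) \<Longrightarrow>
      G (n + t) = G n + rvec w \<bullet> n + form (rvec w) (rvec w) / 2"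
  shows "\<phi> \<in> metrics \<Phi> a b"
proof -
  have "continuous_on Tan (\<lambda>x :: 'g point. G (trop x))"
    by (rule continuous_on_compose2[OF cont continuous_on_Tan_trop]) simp
  then have "continuous_on Tan \<phi>"
    by (simp add: \<phi> cong: continuous_on_cong)
  moreover have "\<phi> (translate b l x)
      = \<phi> x - ln (absK (a l)) - ln (x (Poly_Mapping.single (\<Phi> l) 1))" if x: "x \<in> Tan" for l x
  proof -
    obtain t where t: "trop (translate b l x) = trop x + t" "\<And>y. form (rvec (\<Phi> l)) y = t \<bullet> y"
      using trop_translate_Phi[OF x, of l] by blast
    have "translate b l x \<in> Tan"
      by (rule translate_in_Tan[of b, OF b_nonzero b_add_right x])
    then have "\<phi> (translate b l x) = G (trop x) + rvec (\<Phi> l) \<bullet> trop x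
        + form (rvec (\<Phi> l)) (rvec (\<Phi> l)) / 2"
      by (simp add: \<phi> t(1) shift[OF t(2)])
    then show ?thesis
      using x by (simp add: \<phi> form_Phi_Phi Tan_single)
  qed
  ultimately show ?thesis
    by (simp add: metrics_def)
qed

lemma nacy_metric_in_metrics: "nacy_metric \<Phi> b \<in> metrics \<Phi> a b"
  by (rule metric_if_legendre[OF nacy_metric_eq continuous_legendre legendre_shift])

lemma balanced_metric_in_metrics:
  assumes "k \<ge> 2" and "\<And>\<mu>. \<mu> \<in> coker (mult_hom k \<Phi>) \<Longrightarrow> lift \<mu> \<in> \<mu>"
  shows "balanced_metric \<Phi> a b v k (ak k) lift \<in> metrics \<Phi> a b"
  by (rule metric_if_legendre[OF balanced_metric_eq[OF assms] continuous_lattice_legendre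
        lattice_legendre_shift]) (use assms(1) in auto)

lemma sup_dist_bounds:
  fixes \<phi> \<psi> :: "'g point \<Rightarrow> real"
  assumes bound: "\<And>x. x \<in> Tan \<Longrightarrow> \<bar>\<phi> x - \<psi> x\<bar> \<le> e"
  shows "0 \<le> sup_dist b \<phi> \<psi>" "sup_dist b \<phi> \<psi> \<le> ereal e"
proof -
  \<comment> \<open>In \<open>ereal\<close> the supremum over the empty set is minus infinity, so
    nonnegativity requires an orbit.\<close>
  obtain x :: "'g point" where "x \<in> Tan"
    using Tan_nonempty by blast
  then have "range (\<lambda>l. translate b l x) \<in> Xan b"
    by (simp add: Xan_def)
  then show "0 \<le> sup_dist b \<phi> \<psi>"
    unfolding sup_dist_def by (rule SUP_upper2) simp
  show "sup_dist b \<phi> \<psi> \<le> ereal e"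
    unfolding sup_dist_def
  proof (rule SUP_least)
    fix \<xi> assume "\<xi> \<in> Xan b"
    then obtain x where x: "x \<in> Tan" "\<xi> = range (\<lambda>l. translate b l x)"
      by (auto simp: Xan_def)
    then have "translate b 0 x \<in> \<xi>"
      by blast
    then have "(SOME x. x \<in> \<xi>) \<in> \<xi>"
      by (rule someI[where P = "\<lambda>x. x \<in> \<xi>"])
    moreover have "\<xi> \<subseteq> Tan"
      using translate_in_Tan[of b, OF b_nonzero b_add_right x(1)] by (auto simp: x(2))
    ultimately have "(SOME x. x \<in> \<xi>) \<in> Tan"
      by (rule rev_subsetD)
    then show "ereal \<bar>metric_diff \<phi> \<psi> \<xi>\<bar> \<le> ereal e"
      by (simp add: metric_diff_def Let_def bound)
  qed
qed

end

theorem theorem2: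
  fixes \<Phi> :: "'l::ab_group_add \<Rightarrow> int ^ 'g::finite"
    and a :: "'l \<Rightarrow> complex fls"
    and b :: "'l \<Rightarrow> int ^ 'g \<Rightarrow> complex fls"
    and v :: "complex fls alg_closure \<Rightarrow> real"
    and ak :: "nat \<Rightarrow> int ^ 'g \<Rightarrow> complex fls alg_closure"
    and bk :: "nat \<Rightarrow> int ^ 'g \<Rightarrow> int ^ 'g \<Rightarrow> complex fls alg_closure"
    and lift :: "nat \<Rightarrow> (int ^ 'g) set \<Rightarrow> int ^ 'g"
  assumes "polarized_tdav \<Phi> a b"
    and "extends_absK v"
    and "\<And>k. k \<ge> 1 \<Longrightarrow> theta_extension \<Phi> a b k (ak k) (bk k)"
    and "\<And>k \<mu>. k \<ge> 1 \<Longrightarrow> \<mu> \<in> coker (mult_hom k \<Phi>) \<Longrightarrow> lift k \<mu> \<in> \<mu>"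
  shows "(\<forall>\<^sub>F k in sequentially.
            finite (coker (mult_hom k \<Phi>)) \<and>
            (\<forall>\<mu>\<in>coker (mult_hom k \<Phi>). theta \<Phi> a b k (lift k \<mu>) \<in> sections \<Phi> a b k) \<and>
            no_common_zeros (coker (mult_hom k \<Phi>)) (\<lambda>\<mu>. theta \<Phi> a b k (lift k \<mu>))) \<and>
         C0_converges \<Phi> a b (\<lambda>k. balanced_metric \<Phi> a b v k (ak k) (lift k)) (nacy_metric \<Phi> b) \<and>
         (\<lambda>k. real_of_ereal (sup_dist b (nacy_metric \<Phi> b)
                 (balanced_metric \<Phi> a b v k (ak k) (lift k)))) \<in> O(\<lambda>k. 1 / real k ^ 2)"
proof -
  interpret polarized_tdav \<Phi> a b
    by fact
  interpret theta_data \<Phi> a b v ak bk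
    by unfold_locales (use assms(2,3) in auto)
  let ?\<phi> = "\<lambda>k. balanced_metric \<Phi> a b v k (ak k) (lift k)"
  have lift: "lift k \<mu> \<in> \<mu>" if "k \<ge> 2" "\<mu> \<in> coker (mult_hom k \<Phi>)" for k \<mu>
    using assms(4)[of k \<mu>] that by simp
  obtain C where C: "\<And>k n. k > 0 \<Longrightarrow> \<bar>legendre n - lattice_legendre k n\<bar> \<le> C / real k ^ 2"
    using legendre_minus_lattice_legendre by blast
  have bound: "\<bar>nacy_metric \<Phi> b x - ?\<phi> k x\<bar> \<le> C / real k ^ 2" if "k \<ge> 2" "x \<in> Tan" for k x
    using C[of k "trop x"] that by (simp add: nacy_metric_eq balanced_metric_eq[OF that(1) lift that(2)])
  have ge2: "\<forall>\<^sub>F k in sequentially. 2 \<le> (k :: nat)"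
    by (rule eventually_ge_at_top)
  have sections: "\<forall>\<^sub>F k in sequentially. finite (coker (mult_hom k \<Phi>)) \<and>
      (\<forall>\<mu>\<in>coker (mult_hom k \<Phi>). theta \<Phi> a b k (lift k \<mu>) \<in> sections \<Phi> a b k) \<and>
      no_common_zeros (coker (mult_hom k \<Phi>)) (\<lambda>\<mu>. theta \<Phi> a b k (lift k \<mu>))"
    using ge2
  proof eventually_elim
    case (elim k)
    then show ?case
      using finite_coker_mult_hom[of k] theta_in_sections[of k]
        theta_no_common_zeros[OF elim lift[OF elim]] by simp
  qed
  have "(\<lambda>k. C / real k ^ 2) \<longlonglongrightarrow> 0"
    by real_asymp
  then have lim: "(\<lambda>k. ereal (C / real k ^ 2)) \<longlonglongrightarrow> 0"
    unfolding zero_ereal_def by (rule tendsto_ereal)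
  have bounds: "\<forall>\<^sub>F k in sequentially. 0 \<le> sup_dist b (?\<phi> k) (nacy_metric \<Phi> b)
      \<and> sup_dist b (?\<phi> k) (nacy_metric \<Phi> b) \<le> ereal (C / real k ^ 2)"
    using ge2
  proof eventually_elim
    case (elim k)
    then show ?case
      using sup_dist_bounds[of "?\<phi> k" "nacy_metric \<Phi> b" "C / real k ^ 2"] bound[OF elim]
      by (simp add: abs_minus_commute)
  qed
  have "(\<lambda>k. sup_dist b (?\<phi> k) (nacy_metric \<Phi> b)) \<longlonglongrightarrow> 0"
    by (rule tendsto_sandwich[OF _ _ tendsto_const lim]) (use bounds in \<open>auto elim: eventually_mono\<close>)
  then have C0: "C0_converges \<Phi> a b ?\<phi> (nacy_metric \<Phi> b)"
    unfolding C0_converges_def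
    using nacy_metric_in_metrics eventually_mono[OF ge2 balanced_metric_in_metrics[OF _ lift]] by simp
  have "(\<lambda>k. real_of_ereal (sup_dist b (nacy_metric \<Phi> b) (?\<phi> k))) \<in> O(\<lambda>k. 1 / real k ^ 2)"
  proof (rule bigoI)
    show "\<forall>\<^sub>F k in sequentially. norm (real_of_ereal (sup_dist b (nacy_metric \<Phi> b) (?\<phi> k)))
        \<le> C * norm (1 / real k ^ 2)"
      using ge2
    proof eventually_elim
      case (elim k)
      \<comment> \<open>The two bounds exclude infinite values, which \<open>real_of_ereal\<close>
        would silently send to 0.\<close>
      have "0 \<le> sup_dist b (nacy_metric \<Phi> b) (?\<phi> k)"
        "sup_dist b (nacy_metric \<Phi> b) (?\<phi> k) \<le> ereal (C / real k ^ 2)"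
        by (rule sup_dist_bounds, rule bound[OF elim], assumption)+
      then show ?case
        by (cases "sup_dist b (nacy_metric \<Phi> b) (?\<phi> k)") auto
    qed
  qed
  with sections C0 show ?thesis
    by blast
qed

end
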